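(* Let $d\ge 2$. For any $d$ mass assignments $\mu_1,\dots,\mu_d$ on the vertical planes of $\mathbb{R}^d$, there exist a vertical plane $H$ and an axis-parallel wedge in $H$ (possibly degenerate) that bisects each of the $d$ mass distributions $\mu_1^H,\dots,\mu_d^H$.
   Context: A vertical plane in $\mathbb{R}^d$ is a 2-dimensional linear subspace containing $e_d=(0,\dots,0,1)$. For a vertical plane $H$, its vertical direction is $e_d$ and its horizontal direction is the direction in $H$ orthogonal to $e_d$. An axis-parallel wedge in $H$ is the closed region bounded by two rays from a common point $p\in H$, one in a vertical direction and one in a horizontal direction; degenerate cases (closed half-planes bounded by a vertical or horizontal line) are allowed. A wedge bisects a measure if the wedge and the closure of its complement in $H$ have equal measure. A mass distribution on $H$ is a probability measure absolutely continuous with respect to Lebesgue measure on $H$; a mass assignment on the vertical planes is an assignment $H\mapsto\mu^H$ of a mass distribution on each vertical plane $H$, depending continuously on $H$. *)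

theory Defs
  imports "HOL-Probability.Probability"
begin

text \<open>Ambient space: real^'n, with d = CARD('n). The vertical direction is the
  standard basis vector axis k 1 for a fixed coordinate k (playing the role of e_d).\<close>

definition vdir :: "'n::finite \<Rightarrow> real^'n" where
  "vdir k = axis k 1"

definition horiz_unit :: "'n::finite \<Rightarrow> real^'n \<Rightarrow> bool" where
  "horiz_unit k u \<longleftrightarrow> norm u = 1 \<and> u \<bullet> vdir k = 0"

definition vertical_plane :: "'n::finite \<Rightarrow> (real^'n) set \<Rightarrow> bool" where
  "vertical_plane k H \<longleftrightarrow> subspace H \<and> dim H = 2 \<and> vdir k \<in> H"

definition vplane :: "'n::finite \<Rightarrow> real^'n \<Rightarrow> (real^'n) set" where
  "vplane k u = span {u, vdir k}"

definition plane_coords :: "'n::finite \<Rightarrow> real^'n \<Rightarrow> real \<times> real \<Rightarrow> real^'n" where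
  "plane_coords k u x = fst x *\<^sub>R u + snd x *\<^sub>R vdir k"

definition plane_lebesgue :: "'n::finite \<Rightarrow> (real^'n) set \<Rightarrow> (real^'n) measure" where
  "plane_lebesgue k H =
     distr lborel borel (plane_coords k (SOME u. horiz_unit k u \<and> u \<in> H))"

definition mass_distribution :: "'n::finite \<Rightarrow> (real^'n) set \<Rightarrow> (real^'n) measure \<Rightarrow> bool" where
  "mass_distribution k H m \<longleftrightarrow>
     prob_space m \<and> sets m = sets borel \<and> emeasure m (UNIV - H) = 0 \<and>
     absolutely_continuous (plane_lebesgue k H) m"

text \<open>A mass assignment on the vertical planes: H \<mapsto> \<mu> H is a mass distribution on every
  vertical plane H, and depends continuously on H (weak topology on measures; continuity in H
  is expressed through the parametrisation u \<mapsto> span {u, e_d} of the vertical planes by the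
  horizontal unit sphere, which is a quotient map onto the space of vertical planes).\<close>
definition mass_assignment :: "'n::finite \<Rightarrow> ((real^'n) set \<Rightarrow> (real^'n) measure) \<Rightarrow> bool" where
  "mass_assignment k \<mu> \<longleftrightarrow>
     (\<forall>H. vertical_plane k H \<longrightarrow> mass_distribution k H (\<mu> H)) \<and>
     (\<forall>g :: real^'n \<Rightarrow> real. continuous_on UNIV g \<and> bounded (range g) \<longrightarrow>
        continuous_on {u. horiz_unit k u} (\<lambda>u. integral\<^sup>L (\<mu> (vplane k u)) g))"

definition quarter :: "'n::finite \<Rightarrow> real^'n \<Rightarrow> real^'n \<Rightarrow> real \<Rightarrow> (real^'n) set" where
  "quarter k p u \<sigma> = {p + a *\<^sub>R u + b *\<^sub>R (\<sigma> *\<^sub>R vdir k) | a b. a \<ge> 0 \<and> b \<ge> 0}"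

text \<open>Axis-parallel wedges in a vertical plane H: the closed region bounded by a vertical and a
  horizontal ray from a common apex p \<in> H (either the convex quarter-plane or the closed
  three-quarter plane), plus the degenerate closed half-planes bounded by a vertical or a
  horizontal line.\<close>
definition axis_wedge :: "'n::finite \<Rightarrow> (real^'n) set \<Rightarrow> (real^'n) set \<Rightarrow> bool" where
  "axis_wedge k H W \<longleftrightarrow>
     (\<exists>p\<in>H. \<exists>u. horiz_unit k u \<and> u \<in> H \<and> (\<exists>\<sigma>\<in>{-1, 1::real}.
        W = quarter k p u \<sigma> \<or>
        W = closure (H - quarter k p u \<sigma>) \<or>
        W = {p + a *\<^sub>R u + b *\<^sub>R vdir k | a b. a \<ge> 0} \<or>
        W = {p + a *\<^sub>R u + b *\<^sub>R (\<sigma> *\<^sub>R vdir k) | a b. b \<ge> 0}))"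

definition bisects :: "(real^'n::finite) measure \<Rightarrow> (real^'n) set \<Rightarrow> (real^'n) set \<Rightarrow> bool" where
  "bisects m H W \<longleftrightarrow> measure m W = measure m (closure (H - W))"

end

theory Submission
  imports Defs "HOL-Homology.Homology" "HOL-Library.Z2"
begin

text \<open>Identify the unit sphere of the ambient space with pairs of a horizontal vector and a height. To a
  point \<open>x\<close> of it one associates a vertical half-plane \<open>V x\<close> and a horizontal half-plane \<open>U x\<close>, in the
  vertical plane spanned by the horizontal part of \<open>x\<close>; a path of quarter-planes joins them. If no wedge
  on the path bisected all masses, subtracting \<open>1/2\<close> from the masses of the wedges would give a homotopy
  of maps from the sphere to the punctured space with an odd end (\<open>V (- x)\<close> is the complement of \<open>V x\<close>)
  and an end invariant under negating the horizontal part (\<open>U\<close> does not see the sign). The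
  former has odd degree and the latter even degree.

  The degree modulo 2 is detected by the cochain \<open>s\<^sub>0 \<union> \<delta>s\<^sub>1 \<union> \<dots> \<union> \<delta>s\<^sub>m\<close>, where \<open>s\<^sub>j\<close> is an odd
  function of the punctured space that records the sign of the \<open>j\<close>-th coordinate whenever it is nonzero.
  Its coboundary \<open>\<delta>s\<^sub>0 \<union> \<dots> \<union> \<delta>s\<^sub>m\<close> vanishes on simplices on which some coordinate keeps its sign, and
  such simplices are obtained by subdivision.\<close>

section \<open>Odd maps and reflection-invariant maps of punctured space\<close>

declare add_bit_eq_xor [simp del] mult_bit_eq_and [simp del]

lemma bit_add_self: "x + x = (0::bit)"
  by (cases x) auto

lemma bit_minus: "- x = (x::bit)"
  by (cases x) auto

text \<open>Chains keep their integer coefficients; only the pairing with a cochain is reduced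
  modulo 2, which makes orientation signs disappear.\<close>

definition eval_cochain :: "('b \<Rightarrow> bit) \<Rightarrow> ('b \<Rightarrow>\<^sub>0 int) \<Rightarrow> bit" where
  "eval_cochain \<theta> c = (\<Sum>\<sigma>\<in>Poly_Mapping.keys c. of_int (Poly_Mapping.lookup c \<sigma>) * \<theta> \<sigma>)"

lemma eval_cochain_superset:
  assumes "finite A" "Poly_Mapping.keys c \<subseteq> A"
  shows "eval_cochain \<theta> c = (\<Sum>\<sigma>\<in>A. of_int (Poly_Mapping.lookup c \<sigma>) * \<theta> \<sigma>)"
  unfolding eval_cochain_def using assms
  by (intro sum.mono_neutral_left) (auto simp: in_keys_iff)

lemma eval_cochain_diff: "eval_cochain \<theta> (a - b) = eval_cochain \<theta> a - eval_cochain \<theta> b"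
proof -
  let ?A = "Poly_Mapping.keys a \<union> Poly_Mapping.keys b"
  have sub: "finite ?A" "Poly_Mapping.keys a \<subseteq> ?A" "Poly_Mapping.keys b \<subseteq> ?A"
      "Poly_Mapping.keys (a - b) \<subseteq> ?A"
    using keys_diff[of a b] by auto
  show ?thesis
    unfolding eval_cochain_superset[OF sub(1,2)] eval_cochain_superset[OF sub(1,3)]
      eval_cochain_superset[OF sub(1,4)]
    by (simp add: lookup_minus distrib_right sum.distrib)
qed

lemma eval_cochain_0 [simp]: "eval_cochain \<theta> 0 = 0"
  by (simp add: eval_cochain_def)

lemma eval_cochain_minus [simp]: "eval_cochain \<theta> (- a) = eval_cochain \<theta> a"
  using eval_cochain_diff[of \<theta> 0 a] by (simp add: bit_minus)

lemma eval_cochain_add: "eval_cochain \<theta> (a + b) = eval_cochain \<theta> a + eval_cochain \<theta> b"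
  using eval_cochain_diff[of \<theta> a "- b"] by (simp add: bit_minus)

lemma eval_cochain_sum: "eval_cochain \<theta> (sum f I) = (\<Sum>i\<in>I. eval_cochain \<theta> (f i))"
  by (induction I rule: infinite_finite_induct) (auto simp: eval_cochain_add)

lemma eval_cochain_sign [simp]:
  "eval_cochain \<theta> (frag_cmul ((-1) ^ k) c) = eval_cochain \<theta> c"
proof -
  have "(-1) ^ k = (1::int) \<or> (-1) ^ k = (-1::int)"
    by (cases "even k") auto
  then show ?thesis
    by auto
qed

lemma eval_cochain_of [simp]: "eval_cochain \<theta> (frag_of \<sigma>) = \<theta> \<sigma>"
  by (simp add: eval_cochain_def)

lemma eval_cochain_eq_0:
  "(\<And>\<sigma>. \<sigma> \<in> Poly_Mapping.keys c \<Longrightarrow> \<theta> \<sigma> = 0) \<Longrightarrow> eval_cochain \<theta> c = 0"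
  by (simp add: eval_cochain_def)

section \<open>Cup products of 0-cochains and their coboundaries\<close>

definition vertex :: "nat \<Rightarrow> nat \<Rightarrow> real" where
  "vertex j = (\<lambda>i. if i = j then 1 else 0)"

text \<open>The vertex sequence of the \<open>k\<close>-th face of a simplex.\<close>

definition omit :: "nat \<Rightarrow> (nat \<Rightarrow> 'b) \<Rightarrow> nat \<Rightarrow> 'b" where
  "omit k v = (\<lambda>j. v (if j < k then j else Suc j))"

text \<open>For a family of bit-valued functions \<open>s\<^sub>j\<close>, viewed as 0-cochains modulo 2, \<open>cup_delta s q p\<close> is the
  cup product \<open>\<delta>s\<^sub>q \<union> \<dots> \<union> \<delta>s\<^bsub>q+p-1\<^esub>\<close> and \<open>cup_sign s q p\<close> is \<open>s\<^sub>q \<union> \<delta>s\<^bsub>q+1\<^esub> \<union> \<dots> \<union> \<delta>s\<^bsub>q+p\<^esub>\<close>, both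
  evaluated at the vertices of a simplex.\<close>

definition cup_delta :: "(nat \<Rightarrow> 'a \<Rightarrow> bit) \<Rightarrow> nat \<Rightarrow> nat \<Rightarrow> (nat \<Rightarrow> 'a) \<Rightarrow> bit" where
  "cup_delta s q p v = (\<Prod>j<p. s (q + j) (v j) + s (q + j) (v (Suc j)))"

definition cup_sign :: "(nat \<Rightarrow> 'a \<Rightarrow> bit) \<Rightarrow> nat \<Rightarrow> nat \<Rightarrow> (nat \<Rightarrow> 'a) \<Rightarrow> bit" where
  "cup_sign s q p v = s q (v 0) * cup_delta s (Suc q) p v"

lemma cup_delta_Suc:
  "cup_delta s q (Suc p) v = (s q (v 0) + s q (v (Suc 0))) * cup_delta s (Suc q) p (\<lambda>j. v (Suc j))"
  by (simp add: cup_delta_def prod.lessThan_Suc_shift del: prod.lessThan_Suc)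

text \<open>A product of coboundaries is a cocycle. After splitting off the first factor, face 0,
  face 1 and the later faces carry the differences of \<open>s q\<close> along the three edges of
  \<open>v 0, v 1, v 2\<close>. By induction all three multiply \<open>?Q 0\<close>, and around a
  triangle they add up to 0.\<close>

lemma cup_delta_cocycle: "(\<Sum>k\<le>Suc p. cup_delta s q p (omit k v)) = 0"
proof (induction p arbitrary: q v)
  case 0
  show ?case
    by (simp add: cup_delta_def bit_add_self)
next
  case (Suc p)
  let ?v = "\<lambda>j. v (Suc j)" and ?s = "s q"
  let ?Q = "\<lambda>k. cup_delta s (Suc q) p (omit k ?v)"
  have sh: "(\<lambda>j. omit (Suc k) v (Suc j)) = omit k ?v" "(\<lambda>j. omit 0 v (Suc j)) = omit 0 ?v" for k
    by (auto simp: omit_def)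
  have "(\<Sum>k\<le>p. ?Q (Suc k)) = ?Q 0"
    using Suc.IH[of "Suc q" ?v] unfolding sum.atMost_Suc_shift
    by (metis add_eq_0_iff2 bit_minus)
  moreover have "(\<Sum>k\<le>Suc (Suc p). cup_delta s q (Suc p) (omit k v))
      = (?s (v 1) + ?s (v 2)) * ?Q 0 + ((?s (v 0) + ?s (v 2)) * ?Q 0
         + (\<Sum>k\<le>p. (?s (v 0) + ?s (v 1)) * ?Q (Suc k)))"
    unfolding sum.atMost_Suc_shift cup_delta_Suc sh
    by (simp add: omit_def numeral_2_eq_2)
  moreover have "(\<Sum>k\<le>p. (?s (v 0) + ?s (v 1)) * ?Q (Suc k)) = (?s (v 0) + ?s (v 1)) * (\<Sum>k\<le>p. ?Q (Suc k))"
    by (simp only: sum_distrib_left)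
  ultimately have "(\<Sum>k\<le>Suc (Suc p). cup_delta s q (Suc p) (omit k v))
     = ((?s (v 1) + ?s (v 2)) + (?s (v 0) + ?s (v 2)) + (?s (v 0) + ?s (v 1))) * ?Q 0"
    by (simp only: distrib_right add.assoc)
  also have "(?s (v 1) + ?s (v 2)) + (?s (v 0) + ?s (v 2)) + (?s (v 0) + ?s (v 1)) =
      (?s (v 1) + ?s (v 1)) + (?s (v 2) + ?s (v 2)) + (?s (v 0) + ?s (v 0))"
    by (simp only: ac_simps)
  finally show ?case
    by (simp add: bit_add_self)
qed

text \<open>Leibniz rule: the remaining factors form a cocycle, so only the coboundary of the first
  factor survives.\<close>

lemma coboundary_cup_sign: "(\<Sum>k\<le>Suc p. cup_sign s q p (omit k v)) = cup_delta s q (Suc p) v"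
proof -
  let ?Q = "\<lambda>k. cup_delta s (Suc q) p (omit k v)"
  have "(\<Sum>k\<le>p. ?Q (Suc k)) = ?Q 0"
    using cup_delta_cocycle[of s "Suc q" p v] unfolding sum.atMost_Suc_shift
    by (metis add_eq_0_iff2 bit_minus)
  moreover have "(\<Sum>k\<le>Suc p. cup_sign s q p (omit k v)) =
      s q (v 1) * ?Q 0 + s q (v 0) * (\<Sum>k\<le>p. ?Q (Suc k))"
    unfolding sum.atMost_Suc_shift cup_sign_def by (simp add: omit_def sum_distrib_left)
  moreover have "?Q 0 = cup_delta s (Suc q) p (\<lambda>j. v (Suc j))"
    by (simp add: omit_def)
  ultimately show ?thesis
    by (simp add: cup_delta_Suc algebra_simps)
qed

definition cup_delta_simplex ::
    "(nat \<Rightarrow> 'a \<Rightarrow> bit) \<Rightarrow> nat \<Rightarrow> nat \<Rightarrow> ((nat \<Rightarrow> real) \<Rightarrow> 'a) \<Rightarrow> bit" where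
  "cup_delta_simplex s q p \<sigma> = cup_delta s q p (\<lambda>j. \<sigma> (vertex j))"

definition cup_sign_simplex ::
    "(nat \<Rightarrow> 'a \<Rightarrow> bit) \<Rightarrow> nat \<Rightarrow> nat \<Rightarrow> ((nat \<Rightarrow> real) \<Rightarrow> 'a) \<Rightarrow> bit" where
  "cup_sign_simplex s q p \<sigma> = cup_sign s q p (\<lambda>j. \<sigma> (vertex j))"

lemma vertex_in_standard_simplex [simp]: "vertex j \<in> standard_simplex p \<longleftrightarrow> j \<le> p"
  by (simp add: vertex_def)

lemma simplical_face_vertex: "simplical_face k (vertex j) = vertex (if j < k then j else Suc j)"
  by (auto simp: simplical_face_def vertex_def fun_eq_iff)

lemma cup_delta_cong: "(\<And>j. j \<le> p \<Longrightarrow> v j = w j) \<Longrightarrow> cup_delta s q p v = cup_delta s q p w"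
  by (simp add: cup_delta_def)

lemma cup_sign_cong: "(\<And>j. j \<le> p \<Longrightarrow> v j = w j) \<Longrightarrow> cup_sign s q p v = cup_sign s q p w"
  by (simp add: cup_sign_def cong: cup_delta_cong)

lemma cup_sign_simplex_face:
  "cup_sign_simplex s q p (singular_face (Suc p) k \<sigma>) = cup_sign s q p (omit k (\<lambda>j. \<sigma> (vertex j)))"
  unfolding cup_sign_simplex_def
  by (rule cup_sign_cong) (simp add: singular_face_def simplical_face_vertex omit_def)

text \<open>Stokes' formula modulo 2, carrying \<open>coboundary_cup_sign\<close> from simplices to
  chains.\<close>

lemma eval_cochain_boundary:
  "eval_cochain (cup_sign_simplex s q p) (chain_boundary (Suc p) c)
    = eval_cochain (cup_delta_simplex s q (Suc p)) c"
  using subset_UNIV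
proof (induction c rule: frag_induction)
  case (one \<sigma>)
  show ?case
    by (simp add: chain_boundary_of eval_cochain_sum cup_sign_simplex_face coboundary_cup_sign
        cup_delta_simplex_def eval_cochain_add del: sum.atMost_Suc)
qed (auto simp: chain_boundary_diff eval_cochain_diff)

text \<open>Negation adds 1 to every sign. The differences along edges do not change, while the
  leading factor \<open>s q\<close> becomes \<open>s q + 1\<close>; expanding the product gives the
  extra term.\<close>

lemma eval_cochain_antipode:
  fixes s :: "nat \<Rightarrow> 'a::real_normed_vector \<Rightarrow> bit"
  assumes odd: "\<And>j y. y \<noteq> 0 \<Longrightarrow> s j (- y) = s j y + 1"
    and c: "singular_chain p (top_of_set (- {0})) c"
  shows "eval_cochain (cup_sign_simplex s q p) (chain_map p uminus c)
     = eval_cochain (cup_sign_simplex s q p) c + eval_cochain (cup_delta_simplex s (Suc q) p) c"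
  using c unfolding singular_chain_def
proof (induction c rule: frag_induction)
  case (one \<sigma>)
  then have nz: "\<sigma> (vertex j) \<noteq> 0" if "j \<le> p" for j
    using that by (auto simp: singular_simplex_def continuous_map_def Pi_iff)
  have s0: "s q (simplex_map p uminus \<sigma> (vertex 0)) = s q (\<sigma> (vertex 0)) + 1"
    by (simp add: simplex_map_def odd nz)
  have "cup_delta s (Suc q) p (\<lambda>j. simplex_map p uminus \<sigma> (vertex j))
      = cup_delta s (Suc q) p (\<lambda>j. \<sigma> (vertex j))"
    unfolding cup_delta_def
  proof (rule prod.cong [OF refl])
    fix j assume "j \<in> {..<p}"
    then have "s (Suc q + j) (simplex_map p uminus \<sigma> (vertex j))
         + s (Suc q + j) (simplex_map p uminus \<sigma> (vertex (Suc j)))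
      = s (Suc q + j) (\<sigma> (vertex j)) + s (Suc q + j) (\<sigma> (vertex (Suc j))) + (1 + 1)"
      by (simp add: simplex_map_def odd nz del: one_add_one)
    then show "s (Suc q + j) (simplex_map p uminus \<sigma> (vertex j))
         + s (Suc q + j) (simplex_map p uminus \<sigma> (vertex (Suc j)))
      = s (Suc q + j) (\<sigma> (vertex j)) + s (Suc q + j) (\<sigma> (vertex (Suc j)))"
      by (simp only: bit_add_self add_0_right)
  qed
  then show ?case
    by (simp add: cup_sign_simplex_def cup_delta_simplex_def cup_sign_def s0 distrib_right)
next
  case (diff a b)
  then show ?case
    by (simp add: chain_map_diff eval_cochain_diff)
qed auto

section \<open>Iterated subdivision of chains\<close>

lemma singular_chain_subdivision_power:
  "singular_chain p X c \<Longrightarrow> singular_chain p X ((singular_subdivision p ^^ N) c)"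
  by (induction N) (auto intro: singular_chain_singular_subdivision)

lemma singular_subdivision_power_chain_map:
  "singular_chain p X c \<Longrightarrow>
    (singular_subdivision p ^^ N) (chain_map p g c) = chain_map p g ((singular_subdivision p ^^ N) c)"
  by (induction N)
     (auto simp: naturality_singular_subdivision[OF singular_chain_subdivision_power])

lemma chain_boundary_subdivision_power:
  assumes "singular_chain p X c"
  shows "chain_boundary p ((singular_subdivision p ^^ N) c)
    = (singular_subdivision (p - Suc 0) ^^ N) (chain_boundary p c)"
  by (induction N)
     (auto simp: chain_boundary_singular_subdivision[OF singular_chain_subdivision_power[OF assms]])

lemma singular_subdivision_power_cmul:
  "(singular_subdivision p ^^ N) (frag_cmul k c) = frag_cmul k ((singular_subdivision p ^^ N) c)"
  by (induction N) (auto simp: singular_subdivision_def frag_extend_cmul)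

lemma singular_subdivision_power_add:
  "(singular_subdivision p ^^ N) (a + b) = (singular_subdivision p ^^ N) a + (singular_subdivision p ^^ N) b"
  by (induction N) (auto simp: singular_subdivision_add)

lemma singular_subdivision_power_sum:
  "(singular_subdivision p ^^ N) (sum f I) = (\<Sum>i\<in>I. (singular_subdivision p ^^ N) (f i))"
  by (induction I rule: infinite_finite_induct) (auto simp: singular_subdivision_power_add)

section \<open>The cross-polytope and its cycle\<close>

lemma sum_Pow_split:
  fixes f :: "'b set \<Rightarrow> 'c::comm_monoid_add"
  assumes "finite A" "k \<in> A"
  shows "sum f (Pow A) = (\<Sum>S\<in>Pow (A - {k}). f S + f (insert k S))"
proof -
  have "Pow A = Pow (A - {k}) \<union> insert k ` Pow (A - {k})"
    using assms Pow_insert[of k "A - {k}"] by (simp add: insert_absorb)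
  moreover have "Pow (A - {k}) \<inter> insert k ` Pow (A - {k}) = {}"
    by auto
  moreover have "inj_on (insert k) (Pow (A - {k}))"
    by (auto simp: inj_on_def)
  ultimately show ?thesis
    using assms by (simp add: sum.union_disjoint sum.reindex sum.distrib)
qed

definition neg_sign :: "nat set \<Rightarrow> nat \<Rightarrow> real" where
  "neg_sign S j = (if j \<in> S then -1 else 1)"

text \<open>The facet of the cross-polytope in the coordinates \<open>e 0, \<dots>, e p\<close> whose vertices with index in
  \<open>S\<close> are the negative ones.\<close>

definition cross_simplex :: "(nat \<Rightarrow> 'n) \<Rightarrow> nat \<Rightarrow> nat set \<Rightarrow> (nat \<Rightarrow> real) \<Rightarrow> real^'n::finite" where
  "cross_simplex e p S =
    restrict (\<lambda>x. \<Sum>j\<le>p. (neg_sign S j * x j) *\<^sub>R axis (e j) 1) (standard_simplex p)"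

lemma cross_simplex_nth:
  assumes "inj_on e {..p}" "j \<le> p" "x \<in> standard_simplex p"
  shows "cross_simplex e p S x $ e j = neg_sign S j * x j"
proof -
  have "cross_simplex e p S x $ e j = (\<Sum>i\<le>p. if i = j then neg_sign S j * x j else 0)"
  proof -
    have "cross_simplex e p S x $ e j = (\<Sum>i\<le>p. neg_sign S i * x i * (if e i = e j then 1 else 0))"
      using assms by (auto simp: cross_simplex_def axis_def intro!: sum.cong)
    also have "\<dots> = (\<Sum>i\<le>p. if i = j then neg_sign S j * x j else 0)"
      using assms by (intro sum.cong) (auto simp: inj_on_def)
    finally show ?thesis .
  qed
  also have "\<dots> = neg_sign S j * x j"
    using assms(2) by simp
  finally show ?thesis .
qed

lemma singular_simplex_cross_simplex:
  fixes e :: "nat \<Rightarrow> 'n::finite"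
  assumes "inj_on e {..p}"
  shows "singular_simplex p (top_of_set (- {0})) (cross_simplex e p S)"
proof -
  have nz: "cross_simplex e p S x \<noteq> 0" if x: "x \<in> standard_simplex p" for x
  proof
    assume "cross_simplex e p S x = 0"
    then have "x j = 0" if "j \<le> p" for j
      using cross_simplex_nth[OF assms that x, of S] by (auto simp: neg_sign_def split: if_splits)
    then have "(\<Sum>j\<le>p. x j) = 0"
      by simp
    with x show False
      by (simp add: standard_simplex_def)
  qed
  have "continuous_map (subtopology (powertop_real UNIV) (standard_simplex p)) euclidean
      (\<lambda>x. \<Sum>j\<le>p. (neg_sign S j * x j) *\<^sub>R (axis (e j) 1 :: real^'n))"
  proof (intro continuous_map_sum)
    fix j
    have "continuous_map (subtopology (powertop_real UNIV) (standard_simplex p)) euclideanreal (\<lambda>x. x j)"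
      by (intro continuous_map_from_subtopology continuous_map_product_projection) auto
    moreover have "continuous_map euclideanreal euclidean
        (\<lambda>t. (neg_sign S j * t) *\<^sub>R (axis (e j) 1 :: real^'n))"
      by (auto intro!: continuous_intros)
    ultimately show "continuous_map (subtopology (powertop_real UNIV) (standard_simplex p)) euclidean
        (\<lambda>x. (neg_sign S j * x j) *\<^sub>R (axis (e j) 1 :: real^'n))"
      using continuous_map_compose[unfolded comp_def] by blast
  qed auto
  then have "continuous_map (subtopology (powertop_real UNIV) (standard_simplex p)) euclidean
      (cross_simplex e p S)"
    by (rule continuous_map_eq) (auto simp: cross_simplex_def)
  then show ?thesis
    unfolding singular_simplex_def continuous_map_in_subtopology
    using nz by (auto simp: cross_simplex_def)
qed

text \<open>On the \<open>k\<close>-th face the barycentric coordinate \<open>k\<close> is 0, so the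
  sign attached to vertex \<open>k\<close> is invisible: two facets meet there.\<close>

lemma singular_face_cross_simplex_indep:
  assumes "k \<le> p" "0 < p" "S - {k} = T - {k}"
  shows "singular_face p k (cross_simplex e p S) = singular_face p k (cross_simplex e p T)"
proof -
  have eq: "neg_sign S j * simplical_face k x j = neg_sign T j * simplical_face k x j" for x j
    using assms(3) by (cases "j = k") (auto simp: neg_sign_def simplical_face_def)
  then show ?thesis
    using assms unfolding singular_face_def cross_simplex_def
    by (auto simp: fun_eq_iff restrict_def simplical_face_in_standard_simplex eq simp del: mult_cancel_right)
qed

text \<open>The face opposite the last vertex is a facet of the equatorial cross-polytope. This
  connects consecutive dimensions in the induction for odd maps.\<close>

lemma singular_face_cross_simplex_last:
  "singular_face (Suc p) (Suc p) (cross_simplex e (Suc p) S) = cross_simplex e p S"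
proof
  fix x :: "nat \<Rightarrow> real"
  have "simplical_face (Suc p) x j = x j" if "j \<le> p" for j
    using that by (simp add: simplical_face_def)
  moreover have "simplical_face (Suc p) x (Suc p) = 0"
    by (simp add: simplical_face_def)
  ultimately show "singular_face (Suc p) (Suc p) (cross_simplex e (Suc p) S) x = cross_simplex e p S x"
    using simplical_face_in_standard_simplex[of "Suc p" "Suc p" x]
    by (simp add: singular_face_def cross_simplex_def)
qed

lemma cross_simplex_cong:
  "S \<inter> {..p} = T \<inter> {..p} \<Longrightarrow> cross_simplex e p S = cross_simplex e p T"
  unfolding cross_simplex_def by (intro restrict_ext sum.cong refl) (auto simp: neg_sign_def)

lemma simplex_map_uminus_cross_simplex:
  "simplex_map p uminus (cross_simplex e p S) = cross_simplex e p (- S)"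
  unfolding simplex_map_def cross_simplex_def
  by (auto simp: fun_eq_iff restrict_def neg_sign_def sum_negf[symmetric] intro!: sum.cong)

text \<open>The fundamental cycle of the sphere triangulated as a cross-polytope; the parity of the
  number of negative vertices orients the facets.\<close>

definition cross_cycle :: "(nat \<Rightarrow> 'n) \<Rightarrow> nat \<Rightarrow> (real^'n::finite) chain" where
  "cross_cycle e p = (\<Sum>S\<in>Pow {..p}. frag_cmul ((-1) ^ card S) (frag_of (cross_simplex e p S)))"

lemma singular_chain_cross_cycle:
  "inj_on e {..p} \<Longrightarrow> singular_chain p (top_of_set (- {0})) (cross_cycle e p)"
  unfolding cross_cycle_def
  by (intro singular_chain_sum singular_chain_cmul)
     (simp add: singular_chain_of singular_simplex_cross_simplex)

text \<open>The facets \<open>S\<close> and \<open>insert k S\<close> share their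
  \<open>k\<close>-th face and have opposite coefficients, so all faces cancel in pairs.\<close>

lemma chain_boundary_cross_cycle: "chain_boundary p (cross_cycle e p) = 0"
proof (cases "p = 0")
  case True
  then show ?thesis
    by (simp add: chain_boundary_def)
next
  case False
  let ?F = "\<lambda>k S. frag_of (singular_face p k (cross_simplex e p S))"
  have "chain_boundary p (cross_cycle e p)
      = (\<Sum>S\<in>Pow {..p}. \<Sum>k\<le>p. frag_cmul ((-1) ^ k) (frag_cmul ((-1) ^ card S) (?F k S)))"
    using False unfolding cross_cycle_def chain_boundary_sum
    by (simp add: chain_boundary_cmul chain_boundary_of frag_cmul_sum mult.commute)
  also have "\<dots> = (\<Sum>k\<le>p. frag_cmul ((-1) ^ k) (\<Sum>S\<in>Pow {..p}. frag_cmul ((-1) ^ card S) (?F k S)))"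
    unfolding frag_cmul_sum by (rule sum.swap)
  also have "\<dots> = 0"
  proof (intro sum.neutral ballI)
    fix k assume k: "k \<in> {..p}"
    have "(\<Sum>S\<in>Pow {..p}. frag_cmul ((-1) ^ card S) (?F k S)) =
      (\<Sum>S\<in>Pow ({..p} - {k}). frag_cmul ((-1) ^ card S) (?F k S) +
         frag_cmul ((-1) ^ card (insert k S)) (?F k (insert k S)))"
      using k by (intro sum_Pow_split) auto
    also have "\<dots> = 0"
    proof (intro sum.neutral ballI)
      fix S assume S: "S \<in> Pow ({..p} - {k})"
      then have "finite S" "k \<notin> S"
        using finite_subset by auto
      moreover have "?F k (insert k S) = ?F k S"
        using k False by (intro arg_cong[of _ _ frag_of] singular_face_cross_simplex_indep) auto
      ultimately show "frag_cmul ((-1) ^ card S) (?F k S) +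
         frag_cmul ((-1) ^ card (insert k S)) (?F k (insert k S)) = 0"
        by (simp flip: frag_cmul_distrib)
    qed
    finally show "frag_cmul ((-1) ^ k) (\<Sum>S\<in>Pow {..p}. frag_cmul ((-1) ^ card S) (?F k S)) = 0"
      by simp
  qed
  finally show ?thesis .
qed

lemma eval_cochain_cross_cycle:
  "eval_cochain \<theta> ((singular_subdivision p ^^ N) (chain_map p g (cross_cycle e p))) =
    (\<Sum>S\<in>Pow {..p}. eval_cochain \<theta>
       ((singular_subdivision p ^^ N) (chain_map p g (frag_of (cross_simplex e p S)))))"
  unfolding cross_cycle_def
  by (simp add: chain_map_sum singular_subdivision_power_sum singular_subdivision_power_cmul
      eval_cochain_sum)

lemma sum_bit_Pow_eq_0:
  fixes f :: "'b set \<Rightarrow> bit"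
  assumes "finite A" "k \<in> A" "\<And>S. S \<subseteq> A - {k} \<Longrightarrow> f (insert k S) = f S"
  shows "sum f (Pow A) = 0"
  unfolding sum_Pow_split[OF assms(1,2)]
  by (intro sum.neutral ballI) (simp add: assms(3) bit_add_self)

text \<open>For odd \<open>s\<close>, pairing antipodal simplices turns \<open>s\<^sub>q \<union> \<delta>s\<^bsub>q+1\<^esub> \<union> \<dots>\<close> on the cycle into
  \<open>\<delta>s\<^bsub>q+1\<^esub> \<union> \<dots> = \<delta>(s\<^bsub>q+1\<^esub> \<union> \<dots>)\<close> on a hemisphere, hence into \<open>s\<^bsub>q+1\<^esub> \<union> \<dots>\<close> on the equator.\<close>

lemma eval_cochain_odd_map:
  fixes s :: "nat \<Rightarrow> real^'n \<Rightarrow> bit" and e :: "nat \<Rightarrow> 'n::finite"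
  assumes odd: "\<And>j y. y \<noteq> 0 \<Longrightarrow> s j (- y) = s j y + 1"
    and g: "continuous_map (top_of_set (- {0})) (top_of_set (- {0})) g"
    and godd: "\<And>x. x \<noteq> 0 \<Longrightarrow> g (- x) = - g x"
    and inj: "inj_on e {..p}"
  shows "eval_cochain (cup_sign_simplex s q p)
     ((singular_subdivision p ^^ N) (chain_map p g (cross_cycle e p))) = 1"
proof -
  define C where "C p S = (singular_subdivision p ^^ N) (chain_map p g (frag_of (cross_simplex e p S)))" for p S
  have cross: "singular_chain p (top_of_set (- {0})) (frag_of (cross_simplex e p S))"
    if "inj_on e {..p}" for p S
    using that by (simp add: singular_chain_of singular_simplex_cross_simplex)
  have gcross: "singular_chain p (top_of_set (- {0})) (chain_map p g (frag_of (cross_simplex e p S)))"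
    if "inj_on e {..p}" for p S
    using singular_chain_chain_map[OF cross[OF that] g] .
  have C: "singular_chain p (top_of_set (- {0})) (C p S)" if "inj_on e {..p}" for p S
    unfolding C_def using that by (intro singular_chain_subdivision_power gcross)
  have antipode: "C p (- S) = chain_map p uminus (C p S)" if inj: "inj_on e {..p}" for p S
  proof -
    have "simplex_map p g (cross_simplex e p (- S)) = simplex_map p uminus (simplex_map p g (cross_simplex e p S))"
    proof
      fix x
      have "cross_simplex e p S x \<noteq> 0" if "x \<in> standard_simplex p"
        using singular_simplex_cross_simplex[OF inj, of S] that
        by (auto simp: singular_simplex_def continuous_map_def Pi_iff)
      then show "simplex_map p g (cross_simplex e p (- S)) x
          = simplex_map p uminus (simplex_map p g (cross_simplex e p S)) x"
        by (simp add: simplex_map_def godd flip: simplex_map_uminus_cross_simplex)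
    qed
    then show ?thesis
      unfolding C_def using singular_subdivision_power_chain_map[OF gcross[OF inj], of N uminus S] by simp
  qed
  \<comment> \<open>\<open>Pow {..<p}\<close> indexes the facets whose last vertex is positive, a
    hemisphere. The other facets are their antipodes, and each pair leaves only the extra term of
    \<open>eval_cochain_antipode\<close>.\<close>
  have halve: "eval_cochain (cup_sign_simplex s q p)
       ((singular_subdivision p ^^ N) (chain_map p g (cross_cycle e p)))
     = (\<Sum>S\<in>Pow {..<p}. eval_cochain (cup_delta_simplex s (Suc q) p) (C p S))"
    if inj: "inj_on e {..p}" for p q
  proof -
    let ?E = "\<lambda>S. eval_cochain (cup_sign_simplex s q p) (C p S)"
    have p: "{..p} - {p} = {..<p}"
      by auto
    have "(\<Sum>S\<in>Pow {..p}. ?E S) = (\<Sum>S\<in>Pow {..<p}. ?E S + ?E (insert p S))"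
      using sum_Pow_split[of "{..p}" p ?E] by (simp add: p)
    also have "\<dots> = (\<Sum>S\<in>Pow {..<p}. ?E S) + (\<Sum>S\<in>Pow {..<p}. ?E (insert p S))"
      by (rule sum.distrib)
    \<comment> \<open>On the indices up to \<open>p\<close>, \<open>insert p S\<close> is the
      complement of \<open>{..<p} - S\<close>, so it names the antipode of a hemisphere
      facet.\<close>
    also have "(\<Sum>S\<in>Pow {..<p}. ?E (insert p S)) = (\<Sum>S\<in>Pow {..<p}. ?E (- S))"
    proof (rule sum.reindex_bij_witness[of _ "\<lambda>S. {..<p} - S" "\<lambda>S. {..<p} - S"])
      fix S assume "S \<in> Pow {..<p}"
      then have "(- ({..<p} - S)) \<inter> {..p} = insert p S \<inter> {..p}"
        by auto
      then have "cross_simplex e p (- ({..<p} - S)) = cross_simplex e p (insert p S)"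
        by (rule cross_simplex_cong)
      then show "?E (- ({..<p} - S)) = ?E (insert p S)"
        by (simp only: C_def)
    qed auto
    also have "\<dots> = (\<Sum>S\<in>Pow {..<p}. ?E S + eval_cochain (cup_delta_simplex s (Suc q) p) (C p S))"
      using eval_cochain_antipode[where s = s, OF odd C[OF inj]] by (simp add: antipode[OF inj])
    also have "(\<Sum>S\<in>Pow {..<p}. ?E S) + \<dots> =
      (\<Sum>S\<in>Pow {..<p}. eval_cochain (cup_delta_simplex s (Suc q) p) (C p S))"
      by (simp only: sum.distrib bit_add_self add.assoc[symmetric] add_0)
    finally show ?thesis
      by (simp only: eval_cochain_cross_cycle C_def)
  qed
  show ?thesis
    using inj
  \<comment> \<open>\<open>q\<close> varies because passing to the equator replaces it by
    \<open>Suc q\<close>.\<close>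
  proof (induction p arbitrary: q)
    case 0
    \<comment> \<open>Subdivision does nothing in dimension 0; the hemisphere is a single point, on
      which the empty product is 1.\<close>
    have "C 0 {} = frag_of (simplex_map 0 g (cross_simplex e 0 {}))"
    proof -
      have "(singular_subdivision 0 ^^ M) (frag_of (simplex_map 0 g (cross_simplex e 0 {})))
          = frag_of (simplex_map 0 g (cross_simplex e 0 {}))" for M
      proof (induction M)
        case (Suc M)
        then show ?case
          using singular_subdivision_zero gcross[OF 0, of "{}"] by auto
      qed auto
      then show ?thesis
        by (simp add: C_def)
    qed
    then show ?case
      by (simp add: halve[OF 0] cup_delta_simplex_def cup_delta_def)
  next
    case (Suc p)
    have inj: "inj_on e {..p}"
      using Suc.prems by (rule inj_on_subset) auto
    define H where "H k S = eval_cochain (cup_sign_simplex s (Suc q) p)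
      ((singular_subdivision p ^^ N) (chain_map p g (frag_of (singular_face (Suc p) k (cross_simplex e (Suc p) S)))))"
      for k S
    have "eval_cochain (cup_delta_simplex s (Suc q) (Suc p)) (C (Suc p) S) = (\<Sum>k\<le>Suc p. H k S)" for S
    proof -
      have "eval_cochain (cup_delta_simplex s (Suc q) (Suc p)) (C (Suc p) S) =
          eval_cochain (cup_sign_simplex s (Suc q) p) ((singular_subdivision p ^^ N)
            (chain_map p g (chain_boundary (Suc p) (frag_of (cross_simplex e (Suc p) S)))))"
        unfolding eval_cochain_boundary[symmetric] C_def
        using chain_boundary_subdivision_power[OF gcross[OF Suc.prems], of N S]
          chain_boundary_chain_map[OF cross[OF Suc.prems], of g S] by (simp del: chain_map_of)
      then show ?thesis
        unfolding H_def
        by (simp add: chain_boundary_of chain_map_sum singular_subdivision_power_sum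
            singular_subdivision_power_cmul eval_cochain_sum del: sum.atMost_Suc)
    qed
    then have "(\<Sum>S\<in>Pow {..<Suc p}. eval_cochain (cup_delta_simplex s (Suc q) (Suc p)) (C (Suc p) S))
       = (\<Sum>k\<le>Suc p. \<Sum>S\<in>Pow {..<Suc p}. H k S)"
      by (simp only: sum.swap[of _ "{..Suc p}"])
    also have "\<dots> = (\<Sum>k\<le>p. \<Sum>S\<in>Pow {..<Suc p}. H k S) + (\<Sum>S\<in>Pow {..<Suc p}. H (Suc p) S)"
      by simp
    \<comment> \<open>Such faces are interior to the hemisphere: each is shared by the facets
      \<open>S\<close> and \<open>insert k S\<close>, both of which belong to it.\<close>
    also have "(\<Sum>k\<le>p. \<Sum>S\<in>Pow {..<Suc p}. H k S) = 0"
    proof (rule sum.neutral, rule ballI)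
      fix k assume k: "k \<in> {..p}"
      show "(\<Sum>S\<in>Pow {..<Suc p}. H k S) = 0"
      proof (rule sum_bit_Pow_eq_0[where k = k])
        fix S assume "S \<subseteq> {..<Suc p} - {k}"
        show "H k (insert k S) = H k S"
          unfolding H_def using k singular_face_cross_simplex_indep[of k "Suc p" "insert k S" S e] by simp
      qed (use k in \<open>auto simp: less_Suc_eq_le\<close>)
    qed
    \<comment> \<open>The faces opposite the last vertex make up the equatorial cycle.\<close>
    also have "(\<Sum>S\<in>Pow {..<Suc p}. H (Suc p) S) = 1"
      using Suc.IH[OF inj, of "Suc q"]
      unfolding H_def singular_face_cross_simplex_last eval_cochain_cross_cycle lessThan_Suc_atMost .
    finally show ?case
      by (simp add: halve[OF Suc.prems])
  qed
qed

section \<open>Sign functions and the degree contradiction\<close>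

text \<open>A 0-cochain may be discontinuous, so where the coordinate vanishes the sign is fixed by
  choosing one point \<open>rep y\<close> of each antipodal pair.\<close>

lemma odd_sign_functions_exist:
  obtains s :: "'n::finite \<Rightarrow> real^'n \<Rightarrow> bit" where
    "\<And>i y. y \<noteq> 0 \<Longrightarrow> s i (- y) = s i y + 1"
    "\<And>i y. y $ i > 0 \<Longrightarrow> s i y = 1" "\<And>i y. y $ i < 0 \<Longrightarrow> s i y = 0"
proof -
  define rep :: "real^'n \<Rightarrow> real^'n" where "rep y = (SOME z. z = y \<or> z = - y)" for y
  define s :: "'n \<Rightarrow> real^'n \<Rightarrow> bit" where
    "s i y = (if y $ i > 0 then 1 else if y $ i < 0 then 0 else of_bool (y = rep y))" for i y
  have rep: "rep (- y) = rep y" "rep y = y \<or> rep y = - y" for y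
  proof -
    show "rep (- y) = rep y"
      unfolding rep_def by (rule arg_cong[of _ _ Eps]) auto
    show "rep y = y \<or> rep y = - y"
      unfolding rep_def by (rule someI_ex) auto
  qed
  have "s i (- y) = s i y + 1" if "y \<noteq> 0" for i y
  proof (cases "y $ i = 0")
    case True
    have "y \<noteq> - y"
      using that by (metis add.right_inverse scaleR_2 scaleR_eq_0_iff zero_neq_numeral)
    then have "of_bool (- y = rep (- y)) = of_bool (y = rep y) + (1::bit)"
      using rep[of y] by (auto simp: bit_add_self)
    with True show ?thesis
      by (simp add: s_def)
  qed (auto simp: s_def bit_add_self)
  then show ?thesis
    by (rule that[of s]) (auto simp: s_def)
qed

definition reflect_except :: "'n \<Rightarrow> real^'n \<Rightarrow> real^'n::finite" where
  "reflect_except k x = (\<chi> i. if i = k then x $ i else - x $ i)"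

text \<open>The two ends push the cross-polytope cycle to homologous cycles. After a fine
  subdivision the cochain takes equal values on them, but it is 1 at the odd end and 0 at the
  invariant one.\<close>

theorem no_homotopy_odd_reflection_invariant:
  fixes G :: "real \<times> (real^'n::finite) \<Rightarrow> real^'n"
  assumes card: "CARD('n) \<ge> 2"
    and contG: "continuous_on ({0..1} \<times> - {0}) G"
    and nz: "\<And>t x. \<lbrakk>t \<in> {0..1}; x \<noteq> 0\<rbrakk> \<Longrightarrow> G (t, x) \<noteq> 0"
    and odd: "\<And>x. x \<noteq> 0 \<Longrightarrow> G (1, - x) = - G (1, x)"
    and refl: "\<And>x. x \<noteq> 0 \<Longrightarrow> G (0, reflect_except k x) = G (0, x)"
  shows False
proof -
  obtain m where m: "CARD('n) = Suc m" "0 < m"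
    using card by (cases "CARD('n)") auto
  obtain e where e: "bij_betw e {..m} (UNIV :: 'n set)"
    using ex_bij_betw_nat_finite[of "UNIV :: 'n set"] m(1)
    by (auto simp: atLeast0LessThan lessThan_Suc_atMost)
  then have inj: "inj_on e {..m}"
    by (simp add: bij_betw_def)
  obtain s0 :: "'n \<Rightarrow> real^'n \<Rightarrow> bit" where s0:
    "\<And>i y. y \<noteq> 0 \<Longrightarrow> s0 i (- y) = s0 i y + 1"
    "\<And>i y. y $ i > 0 \<Longrightarrow> s0 i y = 1" "\<And>i y. y $ i < 0 \<Longrightarrow> s0 i y = 0"
    using odd_sign_functions_exist by blast
  define s where "s j = s0 (e j)" for j
  define g0 where "g0 = (\<lambda>x. G (0, x))"
  define g1 where "g1 = (\<lambda>x. G (1, x))"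
  let ?X = "top_of_set (- {0 :: real^'n})"
  let ?z = "cross_cycle e m"
  have Gim: "G \<in> {0..1} \<times> - {0} \<rightarrow> - {0}"
    using nz by force
  then have hom: "homotopic_with (\<lambda>_. True) ?X ?X g0 g1"
  proof -
    have "continuous_map (prod_topology (top_of_set {0..1}) ?X) ?X G"
      using contG Gim
      by (simp add: subtopology_Times[symmetric] continuous_map_in_subtopology)
    then show ?thesis
      unfolding homotopic_with_def by (intro exI[of _ G]) (simp add: g0_def g1_def)
  qed
  then have g1: "continuous_map ?X ?X g1"
    using homotopic_with_imp_continuous_maps by blast
  have "homologous_rel m ?X {} (chain_map m g0 ?z) (chain_map m g1 ?z)"
  proof (rule homotopic_imp_homologous_rel_chain_maps)
    show "singular_relcycle m ?X {} ?z"
      by (simp add: singular_cycle singular_chain_cross_cycle[OF inj] chain_boundary_cross_cycle)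
  qed (use hom in auto)
  then obtain d where d: "singular_chain (Suc m) ?X d"
    "chain_boundary (Suc m) d = chain_map m g0 ?z - chain_map m g1 ?z"
    unfolding homologous_rel_def singular_boundary by blast
  \<comment> \<open>The open half-spaces on which one coordinate keeps a strict sign cover the
    punctured space; subdivision puts each simplex of the homology \<open>d\<close> into one of
    them.\<close>
  define \<C> where "\<C> = range (\<lambda>i. {y :: real^'n. y $ i > 0}) \<union> range (\<lambda>i. {y :: real^'n. y $ i < 0})"
  have "openin ?X U" if "U \<in> \<C>" for U
  proof -
    have "open U"
      using that by (auto simp: \<C>_def intro!: open_Collect_less continuous_intros)
    moreover have "U \<subseteq> - {0}"
      using that by (auto simp: \<C>_def)
    ultimately show ?thesis
      unfolding openin_open by blast
  qed
  moreover have "topspace ?X \<subseteq> \<Union>\<C>"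
  proof
    fix y assume "y \<in> topspace ?X"
    then obtain i where "y $ i \<noteq> 0"
      by (auto simp: vec_eq_iff)
    then show "y \<in> \<Union>\<C>"
      using linorder_neqE_linordered_idom[of "y $ i" 0] by (auto simp: \<C>_def)
  qed
  ultimately obtain N where N: "\<And>f. f \<in> Poly_Mapping.keys ((singular_subdivision (Suc m) ^^ N) d)
      \<Longrightarrow> \<exists>V\<in>\<C>. f \<in> standard_simplex (Suc m) \<rightarrow> V"
    using sufficient_iterated_singular_subdivision_exists[of \<C> ?X "Suc m" d] d(1) by (metis order_refl)
  let ?ev = "eval_cochain (cup_sign_simplex s 0 m)"
  have "?ev ((singular_subdivision m ^^ N) (chain_map m g0 ?z))
      - ?ev ((singular_subdivision m ^^ N) (chain_map m g1 ?z))
      = ?ev (chain_boundary (Suc m) ((singular_subdivision (Suc m) ^^ N) d))"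
    by (simp only: chain_boundary_subdivision_power[OF d(1)] d(2) singular_subdivision_power_diff
        eval_cochain_diff diff_Suc_Suc minus_nat.diff_0)
  also have "\<dots> = eval_cochain (cup_delta_simplex s 0 (Suc m)) ((singular_subdivision (Suc m) ^^ N) d)"
    by (rule eval_cochain_boundary)
  also have "\<dots> = 0"
  proof (rule eval_cochain_eq_0)
    fix \<sigma> assume "\<sigma> \<in> Poly_Mapping.keys ((singular_subdivision (Suc m) ^^ N) d)"
    then obtain V where V: "V \<in> \<C>" "\<sigma> \<in> standard_simplex (Suc m) \<rightarrow> V"
      using N by blast
    obtain i where i: "V = {y. y $ i > 0} \<or> V = {y. y $ i < 0}"
      using V(1) by (auto simp: \<C>_def)
    obtain j where j: "j \<le> m" "e j = i"
      using e by (metis atMost_iff bij_betw_iff_bijections iso_tuple_UNIV_I)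
    \<comment> \<open>The coordinate with constant sign has some index \<open>j\<close> under
      \<open>e\<close>, and the \<open>j\<close>-th factor compares its signs at vertices
      \<open>j\<close> and \<open>Suc j\<close>.\<close>
    have "\<sigma> (vertex j) \<in> V" "\<sigma> (vertex (Suc j)) \<in> V"
      using V(2) j(1) by auto
    then have "s j (\<sigma> (vertex j)) + s j (\<sigma> (vertex (Suc j))) = 0"
      using i by (auto simp: s_def j s0 bit_add_self)
    then show "cup_delta_simplex s 0 (Suc m) \<sigma> = 0"
      unfolding cup_delta_simplex_def cup_delta_def
      using j(1) by (intro prod_zero) auto
  qed
  finally have eq: "?ev ((singular_subdivision m ^^ N) (chain_map m g0 ?z))
      = ?ev ((singular_subdivision m ^^ N) (chain_map m g1 ?z))"
    by (simp only: right_minus_eq)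
  have "?ev ((singular_subdivision m ^^ N) (chain_map m g1 ?z)) = 1"
    using odd s0(1) by (intro eval_cochain_odd_map[OF _ g1 _ inj]) (auto simp: g1_def s_def)
  moreover have "?ev ((singular_subdivision m ^^ N) (chain_map m g0 ?z)) = 0"
  proof -
    obtain \<kappa> where \<kappa>: "\<kappa> \<le> m" "e \<kappa> = k"
      using e by (metis atMost_iff bij_betw_iff_bijections iso_tuple_UNIV_I)
    define D where "D = {..m} - {\<kappa>}"
    obtain a where a: "a \<in> D"
      using m(2) by (cases "\<kappa> = 0") (auto simp: D_def)
    let ?E = "\<lambda>S. ?ev ((singular_subdivision m ^^ N) (chain_map m g0 (frag_of (cross_simplex e m S))))"
    \<comment> \<open>Symmetric difference with \<open>D\<close> flips all signs except that of
      coordinate \<open>k\<close>, which is the action of \<open>reflect_except k\<close> on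
      facets.\<close>
    let ?r = "\<lambda>S. (S - D) \<union> (D - S)"
    have inv: "?E (?r S) = ?E S" for S
    proof -
      have r: "cross_simplex e m (?r S) x = reflect_except k (cross_simplex e m S x)"
        if x: "x \<in> standard_simplex m" for x
      proof (rule vec_eq_iff[THEN iffD2], rule allI)
        fix i
        obtain j where j: "j \<le> m" "e j = i"
          using e by (metis atMost_iff bij_betw_iff_bijections iso_tuple_UNIV_I)
        have "j = \<kappa>" if "e j = k"
          using inj that \<kappa> j(1) by (auto simp: inj_on_def)
        then show "cross_simplex e m (?r S) x $ i = reflect_except k (cross_simplex e m S x) $ i"
          using cross_simplex_nth[OF inj j(1) x] j \<kappa>
          by (auto simp: reflect_except_def neg_sign_def D_def)
      qed
      have "simplex_map m g0 (cross_simplex e m (?r S)) = simplex_map m g0 (cross_simplex e m S)"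
      proof
        fix x
        have "cross_simplex e m S x \<noteq> 0" if "x \<in> standard_simplex m"
          using singular_simplex_cross_simplex[OF inj, of S] that
          by (auto simp: singular_simplex_def continuous_map_def Pi_iff)
        then show "simplex_map m g0 (cross_simplex e m (?r S)) x = simplex_map m g0 (cross_simplex e m S) x"
          by (simp add: simplex_map_def g0_def r refl)
      qed
      then show ?thesis
        by simp
    qed
    \<comment> \<open>As \<open>a\<close> lies in \<open>D\<close>, \<open>?r\<close> exchanges the
      facets with and without \<open>a\<close>, so equal values cancel in pairs.\<close>
    have "(\<Sum>S\<in>Pow {..m}. ?E S) = (\<Sum>S\<in>Pow ({..m} - {a}). ?E S) + (\<Sum>S\<in>Pow ({..m} - {a}). ?E (insert a S))"
      using a by (subst sum_Pow_split[of _ a]) (auto simp: D_def sum.distrib)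
    also have "(\<Sum>S\<in>Pow ({..m} - {a}). ?E (insert a S)) = (\<Sum>S\<in>Pow ({..m} - {a}). ?E S)"
    proof (rule sum.reindex_bij_witness[of _ "\<lambda>S. ?r S - {a}" "\<lambda>S. ?r (insert a S)"])
      show "?E (?r (insert a S)) = ?E (insert a S)" for S
        by (rule inv)
    qed (use a in \<open>auto simp: D_def\<close>)
    finally show ?thesis
      by (simp only: eval_cochain_cross_cycle bit_add_self)
  qed
  ultimately show False
    using eq by simp
qed

section \<open>Vertical planes and weak continuity of wedge masses\<close>

lemma vdir_inner [simp]: "vdir k \<bullet> p = p $ k" "p \<bullet> vdir k = p $ k"
  by (simp_all add: vdir_def inner_axis inner_axis')

lemma norm_vdir [simp]: "norm (vdir k) = 1"
  by (simp add: vdir_def)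

lemma vdir_neq_0 [simp]: "vdir k \<noteq> 0"
  by (metis norm_vdir norm_zero zero_neq_one)

lemma vplane_eq: "vplane k u = {a *\<^sub>R u + b *\<^sub>R vdir k | a b. True}"
proof -
  have "p \<in> vplane k u \<longleftrightarrow> (\<exists>a b. p = a *\<^sub>R u + b *\<^sub>R vdir k)" for p
  proof -
    have "p \<in> vplane k u \<longleftrightarrow> (\<exists>a b. p - a *\<^sub>R u = b *\<^sub>R vdir k)"
      unfolding vplane_def span_insert[of u] span_singleton by auto
    then show ?thesis
      by (simp add: diff_eq_eq add.commute)
  qed
  then show ?thesis
    by auto
qed

lemma vplane_minus:
  fixes u :: "real^'n::finite"
  shows "vplane k (- u) = vplane k u"
proof -
  have "p \<in> vplane k u" if p: "p \<in> vplane k (- u)" for p and u :: "real^'n"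
  proof -
    obtain a b where "p = a *\<^sub>R (- u) + b *\<^sub>R vdir k"
      using p unfolding vplane_eq by blast
    then have "p = (- a) *\<^sub>R u + b *\<^sub>R vdir k"
      by simp
    then show ?thesis
      unfolding vplane_eq by blast
  qed
  from this[of _ u] this[of _ "- u"] show ?thesis
    by auto
qed

lemma independent_horiz_vdir:
  assumes "horiz_unit k u"
  shows "independent {u, vdir k}" "card {u, vdir k} = 2"
proof -
  have "u \<noteq> vdir k"
    using assms by (auto simp: horiz_unit_def vdir_def axis_def)
  then show "card {u, vdir k} = 2"
    by simp
  show "independent {u, vdir k}"
    using assms by (intro pairwise_orthogonal_independent)
      (auto simp: pairwise_def orthogonal_def horiz_unit_def)
qed

lemma vertical_plane_vplane:
  assumes "horiz_unit k u"
  shows "vertical_plane k (vplane k u)"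
  using independent_horiz_vdir[OF assms] indep_card_eq_dim_span[of "{u, vdir k}"]
  by (auto simp: vertical_plane_def vplane_def span_base)

lemma vertical_plane_eq_vplane:
  assumes H: "vertical_plane k H" and u: "horiz_unit k u" "u \<in> H"
  shows "vplane k u = H"
proof -
  have "{u, vdir k} \<subseteq> H"
    using assms by (auto simp: vertical_plane_def)
  then have "H \<subseteq> span {u, vdir k}"
    using H independent_horiz_vdir[OF u(1)]
    by (intro card_ge_dim_independent) (auto simp: vertical_plane_def)
  moreover have "span {u, vdir k} \<subseteq> H"
    using H u(2) by (intro span_minimal) (auto simp: vertical_plane_def)
  ultimately show ?thesis
    by (auto simp: vplane_def)
qed

text \<open>In plane coordinates the set is a line, or empty if \<open>v = 0\<close>. As
  \<open>v\<close> lies in the plane, a nonzero \<open>v\<close> cannot be orthogonal to both basis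
  vectors, so the equation stays nontrivial.\<close>

lemma mass_distribution_line_null:
  assumes u: "horiz_unit k u" and m: "mass_distribution k (vplane k u) m"
    and v: "v \<in> vplane k u" "v \<noteq> 0 \<or> b \<noteq> 0"
  shows "{p. v \<bullet> p + b = 0} \<in> null_sets m"
proof -
  let ?H = "vplane k u"
  \<comment> \<open>The direction chosen inside \<open>plane_lebesgue\<close>; it may differ from
    \<open>u\<close>.\<close>
  define w where "w = (SOME u. horiz_unit k u \<and> u \<in> ?H)"
  have "u \<in> ?H"
    by (simp add: vplane_def span_base)
  with u have w: "horiz_unit k w" "w \<in> ?H"
    unfolding w_def using someI[of "\<lambda>u. horiz_unit k u \<and> u \<in> ?H" u] by auto
  have H: "?H = vplane k w"
    using vertical_plane_eq_vplane[OF vertical_plane_vplane[OF u] w] by simp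
  let ?f = "plane_coords k w"
  have "continuous_on UNIV ?f"
    unfolding plane_coords_def by (intro continuous_intros)
  then have f: "?f \<in> borel_measurable borel"
    by (rule borel_measurable_continuous_onI)
  let ?L = "{p. v \<bullet> p + b = 0}"
  have "closed ?L"
    by (intro closed_Collect_eq continuous_intros)
  then have L: "?L \<in> sets borel"
    by simp
  have pre: "?f -` ?L = {z. (v \<bullet> w, v $ k) \<bullet> z = - b}"
    by (auto simp: plane_coords_def inner_prod_def algebra_simps)
  have "(v \<bullet> w, v $ k) \<noteq> 0 \<or> - b \<noteq> 0"
  proof (rule ccontr)
    assume "\<not> ?thesis"
    then have "v \<bullet> w = 0" "v $ k = 0" "v \<noteq> 0"
      using v(2) by (auto simp: zero_prod_def)
    moreover have "orthogonal v v"
      using v(1)[unfolded H, unfolded vplane_def] calculation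
      by (intro orthogonal_to_span[of v "{w, vdir k}"]) (auto simp: orthogonal_def)
    ultimately show False
      by (simp add: orthogonal_def)
  qed
  then have "negligible (?f -` ?L)"
    unfolding pre by (rule negligible_hyperplane)
  then have "?f -` ?L \<in> null_sets lborel"
    using measurable_sets[OF f L] by (auto simp: negligible_iff_null_sets null_sets_def)
  then have "?L \<in> null_sets (plane_lebesgue k ?H)"
    unfolding plane_lebesgue_def w_def[symmetric]
    using f L by (auto simp: null_sets_def emeasure_distr)
  then show ?thesis
    using m by (auto simp: mass_distribution_def absolutely_continuous_def)
qed

section \<open>Wedge margins and weak limits\<close>

text \<open>Its nonnegativity set is an intersection of two half-spaces. A zero normal with
  nonnegative constant voids one constraint, so half-planes need no separate encoding.\<close>

definition wedge_margin :: "'a::real_inner \<Rightarrow> real \<Rightarrow> 'a \<Rightarrow> real \<Rightarrow> 'a \<Rightarrow> real" where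
  "wedge_margin v b w c p = min (v \<bullet> p + b) (w \<bullet> p + c)"

lemma continuous_wedge_margin: "continuous_on UNIV (wedge_margin v b w c)"
  unfolding wedge_margin_def by (intro continuous_intros)

lemma wedge_margin_close:
  assumes "norm (v' - v) \<le> d" "\<bar>b' - b\<bar> \<le> d" "norm (w' - w) \<le> d" "\<bar>c' - c\<bar> \<le> d"
  shows "\<bar>wedge_margin v' b' w' c' p - wedge_margin v b w c p\<bar> \<le> d * (1 + norm p)"
proof -
  have aux: "\<bar>(v' \<bullet> p + b') - (v \<bullet> p + b)\<bar> \<le> d * (1 + norm p)"
    if "norm (v' - v) \<le> d" "\<bar>b' - b\<bar> \<le> d" for v v' :: 'a and b b'
  proof -
    have "\<bar>(v' - v) \<bullet> p\<bar> \<le> d * norm p"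
      using Cauchy_Schwarz_ineq2[of "v' - v" p] mult_right_mono[OF that(1), of "norm p"] by simp
    then show ?thesis
      using that(2) by (simp add: inner_diff_left algebra_simps)
  qed
  from aux[OF assms(1,2)] aux[OF assms(3,4)] show ?thesis
    unfolding wedge_margin_def by linarith
qed

definition clamp01 :: "real \<Rightarrow> real" where
  "clamp01 r = max 0 (min 1 r)"

lemma clamp01_bounds: "0 \<le> clamp01 r" "clamp01 r \<le> 1"
  by (auto simp: clamp01_def)

lemma clamp01_eq_0: "r \<le> 0 \<Longrightarrow> clamp01 r = 0" and clamp01_eq_1: "1 \<le> r \<Longrightarrow> clamp01 r = 1"
  by (auto simp: clamp01_def)

lemma eventually_linear_below:
  fixes A B :: real
  assumes "A < 0"
  shows "\<forall>\<^sub>F m in sequentially. real (Suc m) * A + B \<le> 0"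
proof -
  obtain M :: nat where M: "B / (- A) < real M"
    using reals_Archimedean2 by blast
  show ?thesis
    using eventually_ge_at_top[of M]
  proof eventually_elim
    case (elim m)
    then have "B / (- A) \<le> real (Suc m)"
      using M by simp
    then show ?case
      using assms by (simp add: field_simps)
  qed
qed

lemma integral_clamp01_tendsto:
  fixes \<phi> :: "real^'n::finite \<Rightarrow> real" and \<nu> :: "(real^'n) measure"
  assumes \<nu>: "prob_space \<nu>" "sets \<nu> = sets borel"
    and g: "\<And>m::nat. continuous_on UNIV (g m)"
    and A: "A \<in> sets borel"
    and lim: "\<And>p. (\<lambda>m. clamp01 (g m p)) \<longlonglongrightarrow> indicat_real A p"
  shows "(\<lambda>m. integral\<^sup>L \<nu> (\<lambda>p. clamp01 (g m p))) \<longlonglongrightarrow> measure \<nu> A"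
proof -
  interpret prob_space \<nu> by fact
  have "(\<lambda>m. integral\<^sup>L \<nu> (\<lambda>p. clamp01 (g m p))) \<longlonglongrightarrow> integral\<^sup>L \<nu> (indicat_real A)"
  proof (rule integral_dominated_convergence[where w = "\<lambda>_. 1"])
    show "(\<lambda>p. clamp01 (g m p)) \<in> borel_measurable \<nu>" for m
    proof -
      have "continuous_on UNIV (\<lambda>p. clamp01 (g m p))"
        unfolding clamp01_def by (intro continuous_intros g)
      then show ?thesis
        using borel_measurable_continuous_onI measurable_cong_sets[OF \<nu>(2) refl] by blast
    qed
    show "indicat_real A \<in> borel_measurable \<nu>"
      using A \<nu>(2) by (intro borel_measurable_indicator) auto
    show "AE p in \<nu>. norm (clamp01 (g m p)) \<le> 1" for m
      by (simp add: clamp01_bounds)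
    show "AE p in \<nu>. (\<lambda>m. clamp01 (g m p)) \<longlonglongrightarrow> indicat_real A p"
      using lim by simp
  qed auto
  then show ?thesis
    using A \<nu>(2) by simp
qed

text \<open>The squeezing functions \<open>U\<close> and \<open>L\<close> allow an error proportional to \<open>1 + norm p\<close>, which absorbs the
  perturbation of the wedge without any tightness of the measures.\<close>

lemma wedge_measure_tendsto:
  fixes \<nu> :: "nat \<Rightarrow> (real^'n::finite) measure"
  assumes \<nu>: "\<And>n. prob_space (\<nu> n)" "\<And>n. sets (\<nu> n) = sets borel"
    and \<nu>0: "prob_space \<nu>0" "sets \<nu>0 = sets borel"
    and weak: "\<And>g :: real^'n \<Rightarrow> real. \<lbrakk>continuous_on UNIV g; bounded (range g)\<rbrakk>
       \<Longrightarrow> (\<lambda>n. integral\<^sup>L (\<nu> n) g) \<longlonglongrightarrow> integral\<^sup>L \<nu>0 g"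
    and lim: "v \<longlonglongrightarrow> v0" "b \<longlonglongrightarrow> b0" "w \<longlonglongrightarrow> w0" "c \<longlonglongrightarrow> c0"
    and null: "{p. wedge_margin v0 b0 w0 c0 p = 0} \<in> null_sets \<nu>0"
  shows "(\<lambda>n. measure (\<nu> n) {p. wedge_margin (v n) (b n) (w n) (c n) p \<ge> 0})
    \<longlonglongrightarrow> measure \<nu>0 {p. wedge_margin v0 b0 w0 c0 p \<ge> 0}"
proof -
  let ?\<phi> = "wedge_margin v0 b0 w0 c0"
  let ?\<psi> = "\<lambda>n. wedge_margin (v n) (b n) (w n) (c n)"
  \<comment> \<open>For parameters within \<open>1 / Suc m\<close> of the limit, \<open>L m\<close>
    and \<open>U m\<close> bound the indicator of the wedge from below and above. In
    \<open>U\<close>, the constant 2 is one unit of error plus the 1 at which \<open>clamp01\<close>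
    saturates.\<close>
  define U where "U m p = clamp01 (2 + norm p + real (Suc m) * ?\<phi> p)" for m p
  define L where "L m p = clamp01 (real (Suc m) * ?\<phi> p - (1 + norm p))" for m p
  let ?W = "{p. ?\<phi> p \<ge> 0}"
  have meas: "{p. wedge_margin v b w c p \<ge> 0} \<in> sets borel" for v b w c and p :: "real^'n"
    by (intro borel_closed closed_Collect_le continuous_intros continuous_wedge_margin)
  have meas': "{p. ?\<phi> p > 0} \<in> sets borel"
    by (intro borel_open open_Collect_less continuous_intros continuous_wedge_margin)
  have cont: "continuous_on UNIV (U m)" "continuous_on UNIV (L m)" for m
    unfolding U_def L_def clamp01_def by (intro continuous_intros continuous_wedge_margin)+
  have bdd: "bounded (range (U m))" "bounded (range (L m))" for m
    unfolding U_def L_def by (auto intro!: boundedI[of _ 1] simp: clamp01_bounds)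
  have int: "integrable (\<nu> n) (U m)" "integrable (\<nu> n) (L m)" for n m
  proof -
    interpret prob_space "\<nu> n" by (rule \<nu>)
    have "U m \<in> borel_measurable (\<nu> n)" "L m \<in> borel_measurable (\<nu> n)"
      using borel_measurable_continuous_onI[OF cont(1)] borel_measurable_continuous_onI[OF cont(2)]
        measurable_cong_sets[OF \<nu>(2) refl] by blast+
    then show "integrable (\<nu> n) (U m)" "integrable (\<nu> n) (L m)"
      by (auto intro!: integrable_const_bound[where B = 1] simp: U_def L_def clamp01_bounds)
  qed
  have squeeze: "\<forall>\<^sub>F n in sequentially. integral\<^sup>L (\<nu> n) (L m) \<le> measure (\<nu> n) {p. ?\<psi> n p \<ge> 0}
      \<and> measure (\<nu> n) {p. ?\<psi> n p \<ge> 0} \<le> integral\<^sup>L (\<nu> n) (U m)" for m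
  proof -
    let ?d = "1 / real (Suc m)"
    have d: "?d > 0"
      by simp
    have "\<forall>\<^sub>F n in sequentially. dist (v n) v0 < ?d" "\<forall>\<^sub>F n in sequentially. dist (b n) b0 < ?d"
      "\<forall>\<^sub>F n in sequentially. dist (w n) w0 < ?d" "\<forall>\<^sub>F n in sequentially. dist (c n) c0 < ?d"
      using lim d by (blast intro: tendstoD)+
    then show ?thesis
    proof eventually_elim
      case (elim n)
      interpret prob_space "\<nu> n" by (rule \<nu>)
      have close: "\<bar>?\<psi> n p - ?\<phi> p\<bar> \<le> ?d * (1 + norm p)" for p
        using elim by (intro wedge_margin_close) (auto simp: dist_norm)
      then have close': "real (Suc m) * \<bar>?\<psi> n p - ?\<phi> p\<bar> \<le> 1 + norm p" for p
        using close[of p] by (simp add: field_simps)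
      have UL: "L m p \<le> indicat_real {p. ?\<psi> n p \<ge> 0} p" "indicat_real {p. ?\<psi> n p \<ge> 0} p \<le> U m p" for p
      proof -
        have "\<bar>real (Suc m) * ?\<psi> n p - real (Suc m) * ?\<phi> p\<bar> \<le> 1 + norm p"
          using close'[of p] by (simp only: abs_mult abs_of_nat flip: right_diff_distrib)
        then have *: "real (Suc m) * ?\<psi> n p - real (Suc m) * ?\<phi> p \<le> 1 + norm p"
          "real (Suc m) * ?\<phi> p - real (Suc m) * ?\<psi> n p \<le> 1 + norm p"
          by linarith+
        show "indicat_real {p. ?\<psi> n p \<ge> 0} p \<le> U m p"
        proof (cases "?\<psi> n p \<ge> 0")
          case True
          then have "real (Suc m) * ?\<psi> n p \<ge> 0"
            by simp
          then show ?thesis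
            using *(1) by (simp add: U_def clamp01_eq_1)
        qed (simp add: U_def clamp01_bounds)
        show "L m p \<le> indicat_real {p. ?\<psi> n p \<ge> 0} p"
        proof (cases "?\<psi> n p \<ge> 0")
          case False
          then have "real (Suc m) * ?\<psi> n p \<le> 0"
            by (simp add: mult_nonneg_nonpos)
          then show ?thesis
            using *(2) by (simp add: L_def clamp01_eq_0)
        qed (simp add: L_def clamp01_bounds)
      qed
      have m1: "measure (\<nu> n) {p. ?\<psi> n p \<ge> 0} = integral\<^sup>L (\<nu> n) (indicat_real {p. ?\<psi> n p \<ge> 0})"
        using meas \<nu>(2) sets_eq_imp_space_eq[OF \<nu>(2)] by simp
      have "integrable (\<nu> n) (indicat_real {p. ?\<psi> n p \<ge> 0})"
        using meas \<nu>(2) sets_eq_imp_space_eq[OF \<nu>(2)]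
        by (simp add: integrable_indicator_iff emeasure_eq_measure)
      then show ?case
        unfolding m1 using UL int by (intro conjI integral_mono)
    qed
  qed
  have limU: "(\<lambda>m. integral\<^sup>L \<nu>0 (U m)) \<longlonglongrightarrow> measure \<nu>0 ?W"
    unfolding U_def
  proof (rule integral_clamp01_tendsto[OF \<nu>0 _ meas])
    fix p
    show "(\<lambda>m. clamp01 (2 + norm p + real (Suc m) * ?\<phi> p)) \<longlonglongrightarrow> indicat_real ?W p"
    proof (rule tendsto_eventually, cases "?\<phi> p \<ge> 0")
      case True
      then have "real (Suc m) * ?\<phi> p \<ge> 0" for m
        by simp
      then have "1 \<le> 2 + norm p + real (Suc m) * ?\<phi> p" for m
        by (smt (verit) norm_ge_zero)
      with True show "\<forall>\<^sub>F m in sequentially. clamp01 (2 + norm p + real (Suc m) * ?\<phi> p) = indicat_real ?W p"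
        by (simp add: clamp01_eq_1)
    next
      case False
      then show "\<forall>\<^sub>F m in sequentially. clamp01 (2 + norm p + real (Suc m) * ?\<phi> p) = indicat_real ?W p"
        using eventually_linear_below[of "?\<phi> p" "2 + norm p"]
        by (auto elim!: eventually_mono simp: clamp01_eq_0 add.commute)
    qed
  qed (intro continuous_intros continuous_wedge_margin)
  have "(\<lambda>m. integral\<^sup>L \<nu>0 (L m)) \<longlonglongrightarrow> measure \<nu>0 {p. ?\<phi> p > 0}"
    unfolding L_def
  proof (rule integral_clamp01_tendsto[OF \<nu>0 _ meas'])
    fix p
    show "(\<lambda>m. clamp01 (real (Suc m) * ?\<phi> p - (1 + norm p))) \<longlonglongrightarrow> indicat_real {p. ?\<phi> p > 0} p"
    proof (rule tendsto_eventually, cases "?\<phi> p > 0")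
      case True
      then show "\<forall>\<^sub>F m in sequentially. clamp01 (real (Suc m) * ?\<phi> p - (1 + norm p)) = indicat_real {p. ?\<phi> p > 0} p"
        using eventually_linear_below[of "- ?\<phi> p" "2 + norm p"]
        by (auto elim!: eventually_mono simp: clamp01_eq_1)
    next
      case False
      then have "real (Suc m) * ?\<phi> p \<le> 0" for m
        by (simp add: mult_nonneg_nonpos)
      then have "real (Suc m) * ?\<phi> p - (1 + norm p) \<le> 0" for m
        by (smt (verit) norm_ge_zero)
      with False show "\<forall>\<^sub>F m in sequentially. clamp01 (real (Suc m) * ?\<phi> p - (1 + norm p)) = indicat_real {p. ?\<phi> p > 0} p"
        by (simp add: clamp01_eq_0)
    qed
  qed (intro continuous_intros continuous_wedge_margin)
  \<comment> \<open>\<open>L\<close> and \<open>U\<close> tend to the open and the closed wedge; the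
    null boundary makes their masses agree.\<close>
  moreover have "measure \<nu>0 {p. ?\<phi> p > 0} = measure \<nu>0 ?W"
  proof -
    have "?W = {p. ?\<phi> p > 0} \<union> {p. ?\<phi> p = 0}"
      by auto
    then show ?thesis
      using measure_Un_null_set[OF _ null, of "{p. ?\<phi> p > 0}"] meas' \<nu>0(2) by simp
  qed
  ultimately have limL: "(\<lambda>m. integral\<^sup>L \<nu>0 (L m)) \<longlonglongrightarrow> measure \<nu>0 ?W"
    by simp
  show ?thesis
  proof (rule tendstoI)
    fix \<epsilon> :: real assume "\<epsilon> > 0"
    then have e2: "\<epsilon> / 2 > 0"
      by simp
    \<comment> \<open>First \<open>m\<close> is fixed, then \<open>n\<close> grows: weak convergence
      is applied to just two test functions.\<close>
    have "\<forall>\<^sub>F m in sequentially. dist (integral\<^sup>L \<nu>0 (U m)) (measure \<nu>0 ?W) < \<epsilon> / 2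
        \<and> dist (integral\<^sup>L \<nu>0 (L m)) (measure \<nu>0 ?W) < \<epsilon> / 2"
      using tendstoD[OF limU e2] tendstoD[OF limL e2] by eventually_elim auto
    then obtain m where m: "dist (integral\<^sup>L \<nu>0 (U m)) (measure \<nu>0 ?W) < \<epsilon> / 2"
        "dist (integral\<^sup>L \<nu>0 (L m)) (measure \<nu>0 ?W) < \<epsilon> / 2"
      using eventually_happens[of _ sequentially] by auto
    show "\<forall>\<^sub>F n in sequentially. dist (measure (\<nu> n) {p. ?\<psi> n p \<ge> 0}) (measure \<nu>0 ?W) < \<epsilon>"
      using tendstoD[OF weak[OF cont(1) bdd(1)] e2, of m] tendstoD[OF weak[OF cont(2) bdd(2)] e2, of m]
        squeeze[of m]
    proof eventually_elim
      case (elim n)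
      then show ?case
        using m unfolding dist_real_def by linarith
    qed
  qed
qed

section \<open>The path of wedges and its excess mass\<close>

definition horiz_part :: "'n::finite \<Rightarrow> real^'n \<Rightarrow> real^'n" where
  "horiz_part k x = x - (x $ k) *\<^sub>R vdir k"

lemma horiz_part_nth [simp]: "horiz_part k x $ k = 0"
  by (simp add: horiz_part_def vdir_def)

lemma horiz_part_minus: "horiz_part k (- x) = - horiz_part k x"
  by (simp add: horiz_part_def)

lemma tendsto_horiz_part [tendsto_intros]:
  "(f \<longlongrightarrow> l) F \<Longrightarrow> ((\<lambda>x. horiz_part k (f x)) \<longlongrightarrow> horiz_part k l) F"
  unfolding horiz_part_def by (intro tendsto_intros)

definition horiz_dir :: "'n::finite \<Rightarrow> real^'n \<Rightarrow> real^'n" where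
  "horiz_dir k x = horiz_part k x /\<^sub>R norm (horiz_part k x)"

lemma horiz_unit_horiz_dir: "horiz_part k x \<noteq> 0 \<Longrightarrow> horiz_unit k (horiz_dir k x)"
  by (simp add: horiz_unit_def horiz_dir_def)

lemma horiz_part_eq_dir: "horiz_part k x = norm (horiz_part k x) *\<^sub>R horiz_dir k x"
  by (cases "horiz_part k x = 0") (auto simp: horiz_dir_def)

text \<open>The sphere of pairs (horizontal vector, height) is the unit sphere of the ambient space. As \<open>t\<close>
  runs from 1 to 0, the wedge of \<open>x\<close> moves from the vertical half-plane
  \<open>{p. horiz_part k x \<bullet> p + x $ k \<ge> 0}\<close>, which is odd in \<open>x\<close>, to the horizontal half-plane
  \<open>{p. norm (horiz_part k x) * p $ k + x $ k \<ge> 0}\<close>, which only depends on \<open>x $ k\<close> and the norm of the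
  horizontal part; in between it is a quarter-plane.
  At vertical \<open>x\<close> it is everything or empty for every \<open>t\<close>.\<close>

definition margin_at :: "'n::finite \<Rightarrow> real \<Rightarrow> real^'n \<Rightarrow> real^'n \<Rightarrow> real" where
  "margin_at k t x = wedge_margin
     (min 1 (2 * t) *\<^sub>R horiz_part k x)
     (min 1 (2 * t) * x $ k + max 0 (1 - 2 * t) * norm x)
     ((min 1 (2 - 2 * t) * norm (horiz_part k x)) *\<^sub>R vdir k)
     (min 1 (2 - 2 * t) * x $ k + max 0 (2 * t - 1) * norm x)"

definition wedge_at :: "'n::finite \<Rightarrow> real \<Rightarrow> real^'n \<Rightarrow> (real^'n) set" where
  "wedge_at k t x = {p. margin_at k t x p \<ge> 0}"

text \<open>Both normals vanish, leaving two constants. If \<open>x $ k\<close> is negative, one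
  constant equals \<open>x $ k\<close>: the second for \<open>t\<close> up to \<open>1/2\<close>,
  the first from there on.\<close>

lemma margin_at_vertical:
  assumes "t \<in> {0..1}" "horiz_part k x = 0" "x \<noteq> 0"
  shows "x $ k > 0 \<and> margin_at k t x p > 0 \<or> x $ k < 0 \<and> margin_at k t x p < 0"
proof -
  have x: "x = (x $ k) *\<^sub>R vdir k"
    using assms(2) by (simp add: horiz_part_def)
  then have nx: "norm x = \<bar>x $ k\<bar>"
    by (metis norm_scaleR norm_vdir mult.right_neutral)
  have "x $ k \<noteq> 0"
    using x assms(3) by auto
  then consider "x $ k > 0" | "x $ k < 0" "t \<le> 1/2" | "x $ k < 0" "t \<ge> 1/2"
    by linarith
  then show ?thesis
  proof cases
    case 1
    have "min 1 (2 * t) + max 0 (1 - 2 * t) > 0" "min 1 (2 - 2 * t) + max 0 (2 * t - 1) > 0"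
      by auto
    then have "(min 1 (2 * t) + max 0 (1 - 2 * t)) * x $ k > 0"
      "(min 1 (2 - 2 * t) + max 0 (2 * t - 1)) * x $ k > 0"
      using 1 by (auto intro: mult_pos_pos)
    then show ?thesis
      using 1 assms(2) by (simp add: margin_at_def wedge_margin_def nx algebra_simps)
  qed (use assms(2) in \<open>auto simp: margin_at_def wedge_margin_def nx\<close>)
qed

text \<open>At vertical \<open>x\<close> no direction is singled out; the values there are those of
  the full and the empty wedge, common to all vertical planes.\<close>

definition excess :: "'n::finite \<Rightarrow> ((real^'n) set \<Rightarrow> (real^'n) measure) \<Rightarrow> real \<Rightarrow> real^'n \<Rightarrow> real" where
  "excess k m t x = (if horiz_part k x = 0 then (if x $ k > 0 then 1/2 else -1/2)
     else measure (m (vplane k (horiz_dir k x))) (wedge_at k t x) - 1/2)"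

text \<open>At vertical \<open>x\<close> any horizontal direction gives the same value, which leaves
  the direction free in limit arguments.\<close>

lemma excess_eq:
  assumes m: "mass_assignment k m" and u: "horiz_unit k u" "horiz_part k x \<noteq> 0 \<Longrightarrow> u = horiz_dir k x"
    and t: "t \<in> {0..1}" and x: "x \<noteq> 0"
  shows "excess k m t x = measure (m (vplane k u)) (wedge_at k t x) - 1/2"
proof (cases "horiz_part k x = 0")
  case True
  have "mass_distribution k (vplane k u) (m (vplane k u))"
    using m vertical_plane_vplane[OF u(1)] by (simp add: mass_assignment_def)
  then interpret prob_space "m (vplane k u)"
    by (simp add: mass_distribution_def)
  have sp: "space (m (vplane k u)) = UNIV"
    using \<open>mass_distribution k (vplane k u) (m (vplane k u))\<close> sets_eq_imp_space_eq[of "m (vplane k u)" borel]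
    by (simp add: mass_distribution_def)
  show ?thesis
  proof (cases "x $ k > 0")
    case pos: True
    then have "wedge_at k t x = UNIV"
      using margin_at_vertical[OF t True x] by (auto simp: wedge_at_def intro: less_imp_le)
    then show ?thesis
      using pos True prob_space by (simp add: excess_def sp)
  next
    case neg: False
    then have "margin_at k t x p < 0" for p
      using margin_at_vertical[OF t True x, of p] by auto
    then have "wedge_at k t x = {}"
      by (auto simp: wedge_at_def not_le)
    then show ?thesis
      using neg True by (simp add: excess_def)
  qed
next
  case False
  then show ?thesis
    using u(2) by (simp add: excess_def)
qed

text \<open>The margin vanishes only on two lines. Neither constraint degenerates to
  \<open>0 = 0\<close>: where a normal vanishes, at \<open>t = 0\<close> or \<open>t = 1\<close>,
  its constant is \<open>norm x\<close>.\<close>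

lemma null_margin_at:
  assumes m: "mass_assignment k m" and u: "horiz_unit k u" "horiz_part k x \<noteq> 0 \<Longrightarrow> u = horiz_dir k x"
    and t: "t \<in> {0..1}" and x: "x \<noteq> 0"
  shows "{p. margin_at k t x p = 0} \<in> null_sets (m (vplane k u))"
proof (cases "horiz_part k x = 0")
  case True
  then have "margin_at k t x p \<noteq> 0" for p
    using margin_at_vertical[OF t True x, of p] by auto
  then show ?thesis
    by simp
next
  case False
  let ?H = "vplane k u"
  have md: "mass_distribution k ?H (m ?H)"
    using m vertical_plane_vplane[OF u(1)] by (simp add: mass_assignment_def)
  let ?v = "min 1 (2 * t) *\<^sub>R horiz_part k x" and ?b = "min 1 (2 * t) * x $ k + max 0 (1 - 2 * t) * norm x"
  let ?w = "(min 1 (2 - 2 * t) * norm (horiz_part k x)) *\<^sub>R vdir k"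
  let ?c = "min 1 (2 - 2 * t) * x $ k + max 0 (2 * t - 1) * norm x"
  have "horiz_part k x = norm (horiz_part k x) *\<^sub>R u"
    using u(2)[OF False] horiz_part_eq_dir by metis
  then have "horiz_part k x \<in> ?H"
    unfolding vplane_def by (metis insertI1 span_base span_scale)
  then have "?v \<in> ?H" "?w \<in> ?H"
    unfolding vplane_def by (auto intro: span_scale span_base)
  moreover have "?v \<noteq> 0 \<or> ?b \<noteq> 0"
    using False t x by (cases "t = 0") auto
  moreover have "?w \<noteq> 0 \<or> ?c \<noteq> 0"
    using False t x by (cases "t = 1") auto
  ultimately have "{p. ?v \<bullet> p + ?b = 0} \<union> {p. ?w \<bullet> p + ?c = 0} \<in> null_sets (m ?H)"
    using mass_distribution_line_null[OF u(1) md] by blast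
  moreover have "{p. margin_at k t x p = 0} \<subseteq> {p. ?v \<bullet> p + ?b = 0} \<union> {p. ?w \<bullet> p + ?c = 0}"
    by (auto simp: margin_at_def wedge_margin_def min_def split: if_splits)
  moreover have "{p. margin_at k t x p = 0} \<in> sets (m ?H)"
  proof -
    have "closed {p. margin_at k t x p = 0}"
      unfolding margin_at_def by (intro closed_Collect_eq continuous_intros continuous_wedge_margin)
    then show ?thesis
      using md by (simp add: mass_distribution_def)
  qed
  ultimately show ?thesis
    using null_sets_subset by blast
qed

section \<open>Continuity of the excess\<close>

lemma excess_tendsto_dir:
  assumes m: "mass_assignment k m" and t: "t \<in> {0..1}" "\<And>n. t' n \<in> {0..1}" "t' \<longlonglongrightarrow> t"
    and x: "x \<noteq> 0" "\<And>n. x' n \<noteq> 0" "x' \<longlonglongrightarrow> x"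
    and u: "horiz_unit k u" "horiz_part k x \<noteq> 0 \<Longrightarrow> u = horiz_dir k x"
    and u': "\<And>n. horiz_unit k (u' n)" "\<And>n. horiz_part k (x' n) \<noteq> 0 \<Longrightarrow> u' n = horiz_dir k (x' n)"
    and lim: "u' \<longlonglongrightarrow> u"
  shows "(\<lambda>n. excess k m (t' n) (x' n)) \<longlonglongrightarrow> excess k m t x"
proof -
  have md: "mass_distribution k (vplane k u) (m (vplane k u))" if "horiz_unit k u" for u
    using m vertical_plane_vplane[OF that] by (simp add: mass_assignment_def)
  have "(\<lambda>n. measure (m (vplane k (u' n))) (wedge_at k (t' n) (x' n)))
      \<longlonglongrightarrow> measure (m (vplane k u)) (wedge_at k t x)"
    unfolding wedge_at_def margin_at_def
  proof (rule wedge_measure_tendsto)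
    fix g :: "real^'a \<Rightarrow> real"
    assume "continuous_on UNIV g" "bounded (range g)"
    then have "continuous_on {u. horiz_unit k u} (\<lambda>u. integral\<^sup>L (m (vplane k u)) g)"
      using m by (simp add: mass_assignment_def)
    then show "(\<lambda>n. integral\<^sup>L (m (vplane k (u' n))) g) \<longlonglongrightarrow> integral\<^sup>L (m (vplane k u)) g"
      using lim u(1) u'(1) by (auto simp: continuous_on_sequentially comp_def)
  next
    show "{p. wedge_margin (min 1 (2 * t) *\<^sub>R horiz_part k x)
       (min 1 (2 * t) * x $ k + max 0 (1 - 2 * t) * norm x)
       ((min 1 (2 - 2 * t) * norm (horiz_part k x)) *\<^sub>R vdir k)
       (min 1 (2 - 2 * t) * x $ k + max 0 (2 * t - 1) * norm x) p = 0} \<in> null_sets (m (vplane k u))"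
      using null_margin_at[OF m u t(1) x(1)] unfolding margin_at_def .
  next
    show "(\<lambda>n. min 1 (2 * t' n) *\<^sub>R horiz_part k (x' n)) \<longlonglongrightarrow> min 1 (2 * t) *\<^sub>R horiz_part k x"
      by (intro tendsto_intros t(3) x(3))
    show "(\<lambda>n. min 1 (2 * t' n) * x' n $ k + max 0 (1 - 2 * t' n) * norm (x' n))
        \<longlonglongrightarrow> min 1 (2 * t) * x $ k + max 0 (1 - 2 * t) * norm x"
      by (intro tendsto_intros t(3) x(3))
    show "(\<lambda>n. (min 1 (2 - 2 * t' n) * norm (horiz_part k (x' n))) *\<^sub>R vdir k)
        \<longlonglongrightarrow> (min 1 (2 - 2 * t) * norm (horiz_part k x)) *\<^sub>R vdir k"
      by (intro tendsto_intros t(3) x(3))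
    show "(\<lambda>n. min 1 (2 - 2 * t' n) * x' n $ k + max 0 (2 * t' n - 1) * norm (x' n))
        \<longlonglongrightarrow> min 1 (2 - 2 * t) * x $ k + max 0 (2 * t - 1) * norm x"
      by (intro tendsto_intros t(3) x(3))
  qed (use md[OF u(1)] md[OF u'(1)] in \<open>simp_all add: mass_distribution_def\<close>)
  moreover have e1: "excess k m t x = measure (m (vplane k u)) (wedge_at k t x) - 1/2"
    by (rule excess_eq[OF m u(1) _ t(1) x(1)]) (rule u(2))
  moreover have e2: "excess k m (t' n) (x' n) = measure (m (vplane k (u' n))) (wedge_at k (t' n) (x' n)) - 1/2"
    for n
    by (rule excess_eq[OF m u'(1) _ t(2) x(2)]) (rule u'(2))
  ultimately show ?thesis
    by (simp only: e1 e2) (intro tendsto_diff tendsto_const)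
qed

lemma compact_horiz_unit: "compact {u. horiz_unit k u}"
proof -
  have "{u. horiz_unit k u} = sphere 0 1 \<inter> {u. u $ k = 0}"
    by (auto simp: horiz_unit_def)
  moreover have "closed {u :: real^'a. u $ k = 0}"
    by (intro closed_Collect_eq continuous_intros)
  ultimately show ?thesis
    by (simp add: compact_Int_closed)
qed

lemma horiz_unit_exists:
  assumes "CARD('n::finite) \<ge> 2"
  shows "\<exists>u. horiz_unit (k :: 'n) u"
proof -
  have "\<exists>j. j \<noteq> k"
  proof (rule ccontr)
    assume "\<not> ?thesis"
    then have "UNIV = {k}"
      by auto
    then have "CARD('n) = card {k}"
      by (rule arg_cong)
    with assms show False
      by simp
  qed
  then obtain j where "j \<noteq> k"
    by blast
  then have "axis j (1::real) $ k = 0"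
    by (simp add: axis_def)
  then have "horiz_unit k (axis j 1)"
    by (simp add: horiz_unit_def)
  then show ?thesis
    by blast
qed

text \<open>Off the vertical axis the directions converge with \<open>x\<close>. On it, every
  subsequence has a further one with convergent directions, and the limit value is the same for all
  of them.\<close>

lemma continuous_on_excess:
  fixes k :: "'n::finite"
  assumes card: "CARD('n) \<ge> 2" and m: "mass_assignment k m"
  shows "continuous_on ({0..1} \<times> - {0}) (\<lambda>z. excess k m (fst z) (snd z))"
  unfolding continuous_on_sequentially
proof (intro allI ballI impI, elim conjE)
  fix z' :: "nat \<Rightarrow> real \<times> (real^'n)" and z
  assume z: "z \<in> {0..1} \<times> - {0}" "\<forall>n. z' n \<in> {0..1} \<times> - {0}" "z' \<longlonglongrightarrow> z"
  obtain u0 where u0: "horiz_unit k u0"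
    using horiz_unit_exists[OF card] by blast
  define t where "t = fst z"
  define x where "x = snd z"
  define t' where "t' = (\<lambda>n. fst (z' n))"
  define x' where "x' = (\<lambda>n. snd (z' n))"
  have t: "t \<in> {0..1}" "\<And>n. t' n \<in> {0..1}" "t' \<longlonglongrightarrow> t"
    and x: "x \<noteq> 0" "\<And>n. x' n \<noteq> 0" "x' \<longlonglongrightarrow> x"
    using z(1,2) tendsto_fst[OF z(3)] tendsto_snd[OF z(3)]
    by (auto simp only: t_def x_def t'_def x'_def mem_Times_iff Compl_iff singleton_iff)
  define u' where "u' n = (if horiz_part k (x' n) = 0 then u0 else horiz_dir k (x' n))" for n
  have u': "\<And>n. horiz_unit k (u' n)" "\<And>n. horiz_part k (x' n) \<noteq> 0 \<Longrightarrow> u' n = horiz_dir k (x' n)"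
    using u0 horiz_unit_horiz_dir by (auto simp: u'_def)
  have "(\<lambda>n. excess k m (t' n) (x' n)) \<longlonglongrightarrow> excess k m t x"
  proof (cases "horiz_part k x = 0")
    case False
    have h: "(\<lambda>n. horiz_part k (x' n)) \<longlonglongrightarrow> horiz_part k x"
      by (intro tendsto_intros x(3))
    then have "\<forall>\<^sub>F n in sequentially. horiz_part k (x' n) \<noteq> 0"
      using False by (rule tendsto_imp_eventually_ne)
    then have "\<forall>\<^sub>F n in sequentially. horiz_dir k (x' n) = u' n"
      by eventually_elim (simp add: u'_def)
    moreover have "(\<lambda>n. horiz_dir k (x' n)) \<longlonglongrightarrow> horiz_dir k x"
      unfolding horiz_dir_def
      by (intro tendsto_scaleR tendsto_inverse tendsto_norm h) (use False in simp)
    ultimately have lim: "u' \<longlonglongrightarrow> horiz_dir k x"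
      by (rule Lim_transform_eventually[rotated])
    show ?thesis
      by (rule excess_tendsto_dir[OF m t x horiz_unit_horiz_dir[OF False] refl u' lim])
  next
    case True
    \<comment> \<open>The directions need not converge here, but the sphere of directions is compact.\<close>
    show ?thesis
    proof (rule ccontr)
      assume "\<not> ?thesis"
      then obtain \<epsilon> where \<epsilon>: "\<epsilon> > 0"
        "\<not> (\<forall>\<^sub>F n in sequentially. dist (excess k m (t' n) (x' n)) (excess k m t x) < \<epsilon>)"
        by (auto simp: tendsto_iff)
      then obtain r :: "nat \<Rightarrow> nat" where r: "strict_mono r"
        "\<And>n. \<not> dist (excess k m (t' (r n)) (x' (r n))) (excess k m t x) < \<epsilon>"
        using not_eventually_sequentiallyD by blast
      obtain u q where q: "horiz_unit k u" "strict_mono q" "(\<lambda>n. u' (r (q n))) \<longlonglongrightarrow> u"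
      proof (rule seq_compactE[OF compact_imp_seq_compact[OF compact_horiz_unit[of k]]])
        show "\<forall>n. u' (r n) \<in> {u. horiz_unit k u}"
          using u'(1) by simp
      qed (simp add: comp_def that)
      have "strict_mono (\<lambda>n. r (q n))"
        using r(1) q(2) by (simp add: strict_mono_def)
      note sub = LIMSEQ_subseq_LIMSEQ[OF _ this, unfolded comp_def]
      have "(\<lambda>n. excess k m (t' (r (q n))) (x' (r (q n)))) \<longlonglongrightarrow> excess k m t x"
        using True by (intro excess_tendsto_dir[OF m t(1) t(2) sub[OF t(3)] x(1) x(2) sub[OF x(3)] q(1) _ u'(1) u'(2) q(3)]) auto
      then have "\<forall>\<^sub>F n in sequentially. dist (excess k m (t' (r (q n))) (x' (r (q n)))) (excess k m t x) < \<epsilon>"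
        using \<epsilon>(1) by (rule tendstoD)
      with r(2) show False
        by simp
    qed
  qed
  then show "((\<lambda>z. excess k m (fst z) (snd z)) \<circ> z') \<longlonglongrightarrow> excess k m (fst z) (snd z)"
    by (simp add: comp_def t_def x_def t'_def x'_def)
qed

section \<open>Complements, oddness and bisection\<close>

lemma measure_closed_complement:
  assumes m: "mass_distribution k H m" and cont: "continuous_on UNIV \<phi>"
    and null: "{p. \<phi> p = (0::real)} \<in> null_sets m"
  shows "measure m {p. \<phi> p \<le> 0} = 1 - measure m {p. \<phi> p \<ge> 0}"
    "measure m {p. \<phi> p < 0} = 1 - measure m {p. \<phi> p \<ge> 0}"
proof -
  interpret prob_space m
    using m by (simp add: mass_distribution_def)
  have sets: "sets m = sets borel"
    using m by (simp add: mass_distribution_def)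
  have meas: "{p. \<phi> p \<ge> 0} \<in> sets m" "{p. \<phi> p < 0} \<in> sets m"
    unfolding sets
    by (intro borel_closed closed_Collect_le cont continuous_on_const)
      (intro borel_open open_Collect_less cont continuous_on_const)
  have "{p. \<phi> p < 0} = space m - {p. \<phi> p \<ge> 0}"
    using sets_eq_imp_space_eq[OF sets] by auto
  then show *: "measure m {p. \<phi> p < 0} = 1 - measure m {p. \<phi> p \<ge> 0}"
    using prob_compl[OF meas(1)] by simp
  have "{p. \<phi> p \<le> 0} = {p. \<phi> p < 0} \<union> {p. \<phi> p = 0}"
    by auto
  then show "measure m {p. \<phi> p \<le> 0} = 1 - measure m {p. \<phi> p \<ge> 0}"
    using measure_Un_null_set[OF meas(2) null] * by simp
qed

lemma continuous_margin_at: "continuous_on UNIV (margin_at k t x)"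
  unfolding margin_at_def by (rule continuous_wedge_margin)

text \<open>At \<open>t = 1\<close> the wedges of \<open>x\<close> and \<open>- x\<close> are
  opposite closed half-planes of one vertical plane, overlapping in a null line.\<close>

lemma excess_odd:
  assumes m: "mass_assignment k m" and x: "x \<noteq> 0"
  shows "excess k m 1 (- x) = - excess k m 1 x"
proof (cases "horiz_part k x = 0")
  case True
  then have "x $ k \<noteq> 0"
    using margin_at_vertical[of 1 k x] x by force
  with True show ?thesis
    by (auto simp: excess_def horiz_part_minus)
next
  case False
  let ?u = "horiz_dir k x" and ?\<phi> = "\<lambda>p. horiz_part k x \<bullet> p + x $ k"
  let ?H = "vplane k ?u"
  have u: "horiz_unit k ?u"
    using False by (rule horiz_unit_horiz_dir)
  have md: "mass_distribution k ?H (m ?H)"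
    using m vertical_plane_vplane[OF u] by (simp add: mass_assignment_def)
  have "{p. margin_at k 1 x p = 0} = {p. ?\<phi> p = 0}"
    using x by (auto simp: margin_at_def wedge_margin_def min_def)
  then have null: "{p. ?\<phi> p = 0} \<in> null_sets (m ?H)"
    using null_margin_at[OF m u _ _ x, of 1] by simp
  have "wedge_at k 1 x = {p. ?\<phi> p \<ge> 0}" "wedge_at k 1 (- x) = {p. ?\<phi> p \<le> 0}"
    by (auto simp: wedge_at_def margin_at_def wedge_margin_def horiz_part_minus)
  moreover have "horiz_dir k (- x) = - ?u"
    by (simp add: horiz_dir_def horiz_part_minus)
  moreover have "continuous_on UNIV ?\<phi>"
    by (intro continuous_intros)
  ultimately show ?thesis
    using False measure_closed_complement(1)[OF md _ null]
    by (simp add: excess_def horiz_part_minus vplane_minus)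
qed

text \<open>The closure of the complement is squeezed between the sets of negative and of
  nonpositive margin, which have equal mass. Intersecting with \<open>H\<close> loses nothing, since
  \<open>m\<close> lives on \<open>H\<close>.\<close>

lemma wedge_at_bisects:
  assumes H: "horiz_unit k u" "H = vplane k u" and m: "mass_distribution k H m"
    and null: "{p. margin_at k t x p = 0} \<in> null_sets m"
    and half: "measure m (wedge_at k t x) = 1/2"
  shows "bisects m H (H \<inter> wedge_at k t x)"
proof -
  interpret prob_space m
    using m by (simp add: mass_distribution_def)
  have sets: "sets m = sets borel" and off: "emeasure m (UNIV - H) = 0"
    using m by (auto simp: mass_distribution_def)
  have cH: "closed H"
    using vertical_plane_vplane[OF H(1)] H(2) by (simp add: vertical_plane_def closed_subspace)
  then have "H \<in> sets m"
    by (simp add: sets)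
  then have "UNIV - H \<in> null_sets m"
    using off sets_eq_imp_space_eq[OF sets] sets.compl_sets[of H m] by (auto simp: null_sets_def)
  have inter: "measure m (H \<inter> A) = measure m A" if "A \<in> sets m" for A
  proof -
    have "H \<inter> A = A - (UNIV - H)"
      by auto
    then show ?thesis
      using measure_Diff_null_set[OF that \<open>UNIV - H \<in> null_sets m\<close>] by simp
  qed
  let ?\<phi> = "margin_at k t x"
  have meas: "{p. ?\<phi> p \<ge> 0} \<in> sets m" "{p. ?\<phi> p \<le> 0} \<in> sets m" "{p. ?\<phi> p < 0} \<in> sets m"
    unfolding sets
    by (intro borel_closed closed_Collect_le continuous_margin_at continuous_on_const
          borel_open[OF open_Collect_less])+
  note compl = measure_closed_complement[OF m continuous_margin_at null]
  have half': "measure m {p. ?\<phi> p \<ge> 0} = 1/2"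
    using half by (simp add: wedge_at_def)
  let ?C = "closure (H - H \<inter> wedge_at k t x)"
  have "H - H \<inter> wedge_at k t x = H \<inter> {p. ?\<phi> p < 0}"
    by (auto simp: wedge_at_def)
  then have lower: "H \<inter> {p. ?\<phi> p < 0} \<subseteq> ?C"
    using closure_subset by metis
  have "closed (H \<inter> {p. ?\<phi> p \<le> 0})"
    by (intro closed_Int cH closed_Collect_le continuous_intros continuous_margin_at)
  then have upper: "?C \<subseteq> H \<inter> {p. ?\<phi> p \<le> 0}"
    by (intro closure_minimal) (auto simp: wedge_at_def)
  have "?C \<in> sets m"
    by (simp add: sets)
  then have "measure m (H \<inter> {p. ?\<phi> p < 0}) \<le> measure m ?C"
    using lower by (intro finite_measure_mono)
  moreover have "measure m ?C \<le> measure m (H \<inter> {p. ?\<phi> p \<le> 0})"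
    using upper meas \<open>H \<in> sets m\<close> by (intro finite_measure_mono) auto
  ultimately have "measure m ?C = 1/2"
    using inter meas compl half' by simp
  moreover have "measure m (H \<inter> wedge_at k t x) = 1/2"
    using inter meas(1) half' by (simp add: wedge_at_def)
  ultimately show ?thesis
    by (simp add: bisects_def)
qed

section \<open>The shape of the wedges\<close>

text \<open>Translates coordinates so that the apex, at \<open>(- r, - s)\<close>, becomes the
  origin.\<close>

lemma coord_set_shift:
  fixes u v :: "'a::real_vector"
  assumes "\<And>a b. P a b \<longleftrightarrow> Q (a + r) (b + s)"
  shows "{a *\<^sub>R u + b *\<^sub>R v | a b. P a b}
    = {(- r) *\<^sub>R u + (- s) *\<^sub>R v + a *\<^sub>R u + b *\<^sub>R v | a b. Q a b}"
proof (intro Set.set_eqI iffI)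
  fix p assume "p \<in> {a *\<^sub>R u + b *\<^sub>R v | a b. P a b}"
  then obtain a b where ab: "p = a *\<^sub>R u + b *\<^sub>R v" "P a b"
    by blast
  then have "p = (- r) *\<^sub>R u + (- s) *\<^sub>R v + (a + r) *\<^sub>R u + (b + s) *\<^sub>R v" "Q (a + r) (b + s)"
    using assms by (simp_all add: algebra_simps)
  then show "p \<in> {(- r) *\<^sub>R u + (- s) *\<^sub>R v + a *\<^sub>R u + b *\<^sub>R v | a b. Q a b}"
    by blast
next
  fix p assume "p \<in> {(- r) *\<^sub>R u + (- s) *\<^sub>R v + a *\<^sub>R u + b *\<^sub>R v | a b. Q a b}"
  then obtain a b where ab: "p = (- r) *\<^sub>R u + (- s) *\<^sub>R v + a *\<^sub>R u + b *\<^sub>R v" "Q a b"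
    by blast
  then have "p = (a - r) *\<^sub>R u + (b - s) *\<^sub>R v" "P (a - r) (b - s)"
    using assms by (simp_all add: algebra_simps)
  then show "p \<in> {a *\<^sub>R u + b *\<^sub>R v | a b. P a b}"
    by blast
qed

lemma axis_wedgeI:
  assumes "p \<in> H" "horiz_unit k u" "u \<in> H"
    "W = {p + a *\<^sub>R u + b *\<^sub>R vdir k | a b. a \<ge> 0 \<and> b \<ge> 0}
      \<or> W = {p + a *\<^sub>R u + b *\<^sub>R vdir k | a b. a \<ge> 0}
      \<or> W = {p + a *\<^sub>R u + b *\<^sub>R vdir k | a b. b \<ge> 0}"
  shows "axis_wedge k H W"
proof -
  have "W = quarter k p u 1 \<or> W = closure (H - quarter k p u 1)
      \<or> W = {p + a *\<^sub>R u + b *\<^sub>R vdir k | a b. a \<ge> 0}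
      \<or> W = {p + a *\<^sub>R u + b *\<^sub>R (1 *\<^sub>R vdir k) | a b. b \<ge> 0}"
    using assms(4) unfolding quarter_def scaleR_one by (elim disjE) simp_all
  then show ?thesis
    unfolding axis_wedge_def
    by (intro bexI[OF _ assms(1)] exI[of _ u] conjI assms(2,3) bexI[of _ 1]) simp_all
qed

text \<open>In the coordinates \<open>a, b\<close> of the plane the first constraint involves only
  \<open>a\<close> and the second only \<open>b\<close>. At \<open>t = 1\<close> the second is void,
  at \<open>t = 0\<close> the first; otherwise both slopes are positive.\<close>

lemma axis_wedge_wedge_at:
  assumes h: "horiz_part k x \<noteq> 0" and t: "t \<in> {0..1}" and H: "H = vplane k (horiz_dir k x)"
  shows "axis_wedge k H (H \<inter> wedge_at k t x)"
proof -
  let ?u = "horiz_dir k x"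
  define n where "n = norm (horiz_part k x)"
  define \<alpha> where "\<alpha> = min 1 (2 * t)"
  define \<beta> where "\<beta> = \<alpha> * x $ k + max 0 (1 - 2 * t) * norm x"
  define \<gamma> where "\<gamma> = min 1 (2 - 2 * t)"
  define \<delta> where "\<delta> = \<gamma> * x $ k + max 0 (2 * t - 1) * norm x"
  have n: "n > 0"
    using h by (simp add: n_def)
  have u: "horiz_unit k ?u" "?u \<in> H"
    using h by (auto simp: horiz_unit_horiz_dir H vplane_def span_base)
  have uu: "?u \<bullet> ?u = 1" "?u $ k = 0"
    using u(1) by (auto simp: horiz_unit_def norm_eq_1)
  have vv: "vdir k $ k = 1"
    by (simp add: vdir_def)
  have hn: "horiz_part k x = n *\<^sub>R ?u"
    unfolding n_def by (rule horiz_part_eq_dir)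
  have margin: "a *\<^sub>R ?u + b *\<^sub>R vdir k \<in> wedge_at k t x \<longleftrightarrow> \<alpha> * n * a + \<beta> \<ge> 0 \<and> \<gamma> * n * b + \<delta> \<ge> 0"
    for a b
    unfolding wedge_at_def margin_at_def wedge_margin_def \<beta>_def \<gamma>_def \<delta>_def \<alpha>_def
    by (subst hn) (simp add: inner_add_right uu vv mult_ac flip: n_def)
  have W: "H \<inter> wedge_at k t x =
      {a *\<^sub>R ?u + b *\<^sub>R vdir k | a b. \<alpha> * n * a + \<beta> \<ge> 0 \<and> \<gamma> * n * b + \<delta> \<ge> 0}"
    unfolding H vplane_eq using margin by blast
  have p: "(- r) *\<^sub>R ?u + (- s) *\<^sub>R vdir k \<in> H" for r s
    unfolding H vplane_def by (intro span_add span_scale span_base) simp_all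
  have aff: "0 \<le> r * a + s \<longleftrightarrow> 0 \<le> a + s / r" if "r > 0" for r a s :: real
  proof -
    have "a + s / r = (r * a + s) / r"
      using that by (simp add: add_divide_distrib)
    then show ?thesis
      using that by (simp add: zero_le_divide_iff)
  qed
  consider "t = 1" | "t = 0" | "0 < t" "t < 1"
    using t by fastforce
  then show ?thesis
  proof cases
    case 1
    have "H \<inter> wedge_at k t x = {(- (\<beta> / n)) *\<^sub>R ?u + (- 0) *\<^sub>R vdir k + a *\<^sub>R ?u + b *\<^sub>R vdir k | a b. a \<ge> 0}"
      unfolding W
    proof (rule coord_set_shift)
      show "0 \<le> \<alpha> * n * a + \<beta> \<and> 0 \<le> \<gamma> * n * b + \<delta> \<longleftrightarrow> 0 \<le> a + \<beta> / n" for a b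
        using aff[OF n, of a \<beta>] 1 by (simp add: \<alpha>_def \<gamma>_def \<delta>_def)
    qed
    then show ?thesis
      by (rule axis_wedgeI[OF p u disjI2[OF disjI1]])
  next
    case 2
    have "H \<inter> wedge_at k t x = {(- 0) *\<^sub>R ?u + (- (\<delta> / n)) *\<^sub>R vdir k + a *\<^sub>R ?u + b *\<^sub>R vdir k | a b. b \<ge> 0}"
      unfolding W
    proof (rule coord_set_shift)
      show "0 \<le> \<alpha> * n * a + \<beta> \<and> 0 \<le> \<gamma> * n * b + \<delta> \<longleftrightarrow> 0 \<le> b + \<delta> / n" for a b
        using aff[OF n, of b \<delta>] 2 by (simp add: \<alpha>_def \<gamma>_def \<beta>_def)
    qed
    then show ?thesis
      by (rule axis_wedgeI[OF p u disjI2[OF disjI2]])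
  next
    case 3
    then have pos: "\<alpha> > 0" "\<gamma> > 0"
      by (auto simp: \<alpha>_def \<gamma>_def)
    have "H \<inter> wedge_at k t x = {(- (\<beta> / (\<alpha> * n))) *\<^sub>R ?u + (- (\<delta> / (\<gamma> * n))) *\<^sub>R vdir k
        + a *\<^sub>R ?u + b *\<^sub>R vdir k | a b. a \<ge> 0 \<and> b \<ge> 0}"
      unfolding W
    proof (rule coord_set_shift)
      show "0 \<le> \<alpha> * n * a + \<beta> \<and> 0 \<le> \<gamma> * n * b + \<delta> \<longleftrightarrow>
          0 \<le> a + \<beta> / (\<alpha> * n) \<and> 0 \<le> b + \<delta> / (\<gamma> * n)" for a b
        using n pos by (simp only: aff mult_pos_pos)
    qed
    then show ?thesis
      by (rule axis_wedgeI[OF p u disjI1])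
  qed
qed

section \<open>Reflection invariance and the conclusion\<close>

lemma horiz_part_reflect_except: "horiz_part k (reflect_except k x) = - horiz_part k x"
  by (auto simp: vec_eq_iff horiz_part_def reflect_except_def vdir_def axis_def)

lemma excess_reflect_except: "excess k m 0 (reflect_except k x) = excess k m 0 x"
proof -
  have "norm (reflect_except k x $ i) = norm (x $ i)" for i
    by (simp add: reflect_except_def)
  then have "norm (reflect_except k x) = norm x"
    by (simp add: norm_vec_def)
  then have "wedge_at k 0 (reflect_except k x) = wedge_at k 0 x"
    by (simp add: wedge_at_def margin_at_def wedge_margin_def horiz_part_reflect_except)
       (simp add: reflect_except_def)
  then show ?thesis
    by (simp add: excess_def horiz_dir_def horiz_part_reflect_except vplane_minus)
       (simp add: reflect_except_def)
qed

theorem theorem1p6: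
  fixes \<mu> :: "'n::finite \<Rightarrow> (real^'n) set \<Rightarrow> (real^'n) measure" and k :: 'n
  assumes "CARD('n) \<ge> 2"
    and "\<forall>i. mass_assignment k (\<mu> i)"
  shows "\<exists>H W. vertical_plane k H \<and> axis_wedge k H W \<and> (\<forall>i. bisects (\<mu> i H) H W)"
proof -
  \<comment> \<open>The masses are indexed by the coordinates, so the excesses form a vector of the
    ambient space; its zeros are the common bisections.\<close>
  define G :: "real \<times> (real^'n) \<Rightarrow> real^'n" where "G z = (\<chi> i. excess k (\<mu> i) (fst z) (snd z))" for z
  have "continuous_on ({0..1} \<times> - {0}) G"
    unfolding G_def using assms by (intro continuous_on_vec_lambda continuous_on_excess) auto
  then obtain t x where t: "t \<in> {0..1}" and x: "x \<noteq> 0" and G: "G (t, x) = 0"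
  proof -
    have "\<exists>t x. t \<in> {0..1} \<and> x \<noteq> 0 \<and> G (t, x) = 0"
    proof (rule ccontr)
      assume "\<not> ?thesis"
      then show False
        using assms \<open>continuous_on ({0..1} \<times> - {0}) G\<close>
        by (intro no_homotopy_odd_reflection_invariant[of G k])
          (auto simp: G_def vec_eq_iff excess_odd excess_reflect_except)
    qed
    with that show ?thesis
      by blast
  qed
  have zero: "excess k (\<mu> i) t x = 0" for i
    using G by (simp add: G_def vec_eq_iff)
  \<comment> \<open>At vertical points the excess is \<open>1/2\<close> or \<open>-1/2\<close>,
    never 0.\<close>
  then have h: "horiz_part k x \<noteq> 0"
    by (auto simp: excess_def split: if_splits)
  let ?u = "horiz_dir k x"
  let ?H = "vplane k ?u"
  have u: "horiz_unit k ?u"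
    using h by (rule horiz_unit_horiz_dir)
  have "bisects (\<mu> i ?H) ?H (?H \<inter> wedge_at k t x)" for i
  proof (rule wedge_at_bisects[OF u refl])
    show "mass_distribution k ?H (\<mu> i ?H)"
      using assms(2) vertical_plane_vplane[OF u] by (simp add: mass_assignment_def)
    show "{p. margin_at k t x p = 0} \<in> null_sets (\<mu> i ?H)"
      using assms(2) by (intro null_margin_at[OF _ u refl t x]) simp
    show "measure (\<mu> i ?H) (wedge_at k t x) = 1 / 2"
      using zero[of i] h by (simp add: excess_def)
  qed
  then show ?thesis
    using vertical_plane_vplane[OF u] axis_wedge_wedge_at[OF h t refl] by blast
qed

end
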